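(* Let $k\ge1$ be an integer and assume Erd\H{o}s' girth conjecture. In the message-passing model with $s$ players and no edge duplication, the randomized communication cost of computing a multiplicative $(2k-1)$-spanner of an $n$-vertex input graph is $\Omega\big(s^{1/2-1/(2k)} n^{1+1/k}+sn\big)$ bits.
   Context: Message-passing model: there are $s$ players $P^1,\dots,P^s$ and a coordinator. All parties know the vertex set $V$, $|V|=n$; player $P^i$ holds an edge set $E_i$ on $V$, and the input graph is $G=(V,\bigcup_i E_i)$ (unweighted, undirected). Communication is only between the coordinator and individual players; the coordinator must output the spanner. Communication cost is the total number of bits exchanged; randomized protocols must succeed with probability at least $2/3$ on every input. "No edge duplication" means the $E_i$ are pairwise disjoint. A multiplicative $\alpha$-spanner of $G$ is a subgraph $H$ with $d_H(u,v)\le \alpha\, d_G(u,v)$ for all $u,v$. Erd\H{o}s' girth conjecture: for every integer $k\ge1$ and every $n$ there is an $n$-vertex graph with $\Omega(n^{1+1/k})$ edges and girth $2k+2$. Standing assumption: $s\ll n$. *)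

theory Defs
  imports "HOL-Probability.Probability"
begin

section \<open>Graphs on the vertex set \<open>{..<n}\<close>, given by their edge sets\<close>

definition all_edges :: "nat \<Rightarrow> nat set set" where
  "all_edges n = {e. e \<subseteq> {..<n} \<and> card e = 2}"

definition adjacency :: "nat set set \<Rightarrow> (nat \<times> nat) set" where
  "adjacency E = {(u, v). {u, v} \<in> E}"

text \<open>The distance is \<open>\<infinity>\<close> between different components, since the infimum of the empty set
  is \<open>\<infinity>\<close>; likewise the girth of a forest is \<open>\<infinity>\<close>.\<close>

definition distance :: "nat set set \<Rightarrow> nat \<Rightarrow> nat \<Rightarrow> enat" where
  "distance E u v = (INF m \<in> {m. (u, v) \<in> adjacency E ^^ m}. enat m)"

definition is_cycle :: "nat set set \<Rightarrow> nat list \<Rightarrow> bool" where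
  "is_cycle E xs \<longleftrightarrow> 3 \<le> length xs \<and> distinct xs \<and>
     (\<forall>i < length xs. {xs ! i, xs ! (Suc i mod length xs)} \<in> E)"

definition girth :: "nat set set \<Rightarrow> enat" where
  "girth E = (INF xs \<in> {xs. is_cycle E xs}. enat (length xs))"

definition is_spanner :: "nat \<Rightarrow> nat \<Rightarrow> nat set set \<Rightarrow> nat set set \<Rightarrow> bool" where
  "is_spanner \<alpha> n E H \<longleftrightarrow> H \<subseteq> E \<and>
     (\<forall>u<n. \<forall>v<n. distance H u v \<le> enat \<alpha> * distance E u v)"

text \<open>The constant in \<open>\<Omega>(n powr (1 + 1 / k))\<close> may depend on \<open>k\<close>, and finitely many
  \<open>n\<close> are excepted for each \<open>k\<close>: no graph on fewer than \<open>2k + 2\<close> vertices has girth \<open>2k + 2\<close>.\<close>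

definition erdos_girth_conjecture :: bool where
  "erdos_girth_conjecture \<longleftrightarrow>
     (\<forall>k::nat. 1 \<le> k \<longrightarrow> (\<exists>c::real. c > 0 \<and>
        (\<forall>\<^sub>F n in sequentially. \<exists>E. E \<subseteq> all_edges n \<and>
           real (card E) \<ge> c * real n powr (1 + 1 / real k) \<and>
           girth E = enat (2 * k + 2))))"

section \<open>The message-passing model\<close>

text \<open>The coordinator has no input, so its behaviour is a decision tree: at every point it either
  stops with an output, sends one bit to a player, or asks a player for one bit and continues
  according to the answer. A longer message is a sequence of such steps. A request is free, but it
  always costs the bit with which the player has to answer, so a player cannot convey anything by
  silence, and charging for requests too would at most double the cost.\<close>

datatype (players: 'p, outputs: 'o) coordinator =
    Output 'o
  | Send 'p bool "('p, 'o) coordinator"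
  | Receive 'p "bool \<Rightarrow> ('p, 'o) coordinator"

text \<open>What has happened on the channel between the coordinator and one player, oldest event
  first.\<close>

datatype event = To_Player bool | From_Player bool

text \<open>A player's next bit depends on its own input and on the history of its own channel only; it
  sees nothing of the other channels.\<close>

type_synonym ('p, 'x) strategies = "'p \<Rightarrow> 'x \<Rightarrow> event list \<Rightarrow> bool"

type_synonym ('p, 'x, 'o) protocol = "('p, 'o) coordinator \<times> ('p, 'x) strategies"

text \<open>Output and number of bits exchanged, when \<open>h i\<close> is the history of player \<open>i\<close>'s channel
  so far and \<open>x i\<close> is its input.\<close>

primrec exec :: "('p, 'o) coordinator \<Rightarrow> ('p, 'x) strategies \<Rightarrow> ('p \<Rightarrow> 'x) \<Rightarrow>
    ('p \<Rightarrow> event list) \<Rightarrow> 'o \<times> nat" where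
  "exec (Output y) \<sigma> x h = (y, 0)"
| "exec (Send i b t) \<sigma> x h =
     apsnd Suc (exec t \<sigma> x (h(i := h i @ [To_Player b])))"
| "exec (Receive i t) \<sigma> x h =
     (let b = \<sigma> i (x i) (h i)
      in apsnd Suc (exec (t b) \<sigma> x (h(i := h i @ [From_Player b]))))"

definition output_of :: "('p, 'x, 'o) protocol \<Rightarrow> ('p \<Rightarrow> 'x) \<Rightarrow> 'o" where
  "output_of \<pi> x = fst (exec (fst \<pi>) (snd \<pi>) x (\<lambda>_. []))"

definition bits_of :: "('p, 'x, 'o) protocol \<Rightarrow> ('p \<Rightarrow> 'x) \<Rightarrow> nat" where
  "bits_of \<pi> x = snd (exec (fst \<pi>) (snd \<pi>) x (\<lambda>_. []))"

text \<open>A randomized protocol is a probability distribution on deterministic protocols (public coins,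
  which subsume private ones). It solves a task, given by the possible inputs and the relation
  between inputs and correct outputs, if it errs with probability at most \<open>1/3\<close> on every input.\<close>

definition solves :: "'p set \<Rightarrow> ('p \<Rightarrow> 'x) set \<Rightarrow> (('p \<Rightarrow> 'x) \<Rightarrow> 'o \<Rightarrow> bool) \<Rightarrow>
    ('p, 'x, 'o) protocol pmf \<Rightarrow> bool" where
  "solves P I correct \<R> \<longleftrightarrow>
     (\<forall>\<pi> \<in> set_pmf \<R>. players (fst \<pi>) \<subseteq> P) \<and>
     (\<forall>x \<in> I. measure_pmf.prob \<R> {\<pi>. correct x (output_of \<pi> x)} \<ge> 2 / 3)"

definition worst_case_bits :: "('p \<Rightarrow> 'x) set \<Rightarrow> ('p, 'x, 'o) protocol pmf \<Rightarrow> enat" where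
  "worst_case_bits I \<R> = (SUP x \<in> I. SUP \<pi> \<in> set_pmf \<R>. enat (bits_of \<pi> x))"

definition randomized_cost :: "'p set \<Rightarrow> ('p \<Rightarrow> 'x) set \<Rightarrow>
    (('p \<Rightarrow> 'x) \<Rightarrow> 'o \<Rightarrow> bool) \<Rightarrow> enat" where
  "randomized_cost P I correct = (INF \<R> \<in> {\<R>. solves P I correct \<R>}. worst_case_bits I \<R>)"

section \<open>Computing spanners without edge duplication\<close>

definition edge_partitions :: "nat \<Rightarrow> nat \<Rightarrow> (nat \<Rightarrow> nat set set) set" where
  "edge_partitions s n =
     {E. (\<forall>i<s. E i \<subseteq> all_edges n) \<and> disjoint_family_on E {..<s}}"

definition spanner_cost :: "nat \<Rightarrow> nat \<Rightarrow> nat \<Rightarrow> enat" where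
  "spanner_cost \<alpha> s n =
     randomized_cost {..<s} (edge_partitions s n) (\<lambda>E H. is_spanner \<alpha> n (\<Union>i<s. E i) H)"

end

theory Submission
  imports Defs
begin

text \<open>Both terms come from one problem. There are \<open>N\<close> coordinates; player \<open>i\<close> holds a subset \<open>X i\<close> of
  them, and for every coordinate the coordinator has to name a player holding it, if there is one.
  Blowing up the vertices of a graph \<open>\<Gamma>\<close> without cycles of length at most \<open>2k\<close>, so that over every
  edge of \<open>\<Gamma>\<close> there are \<open>s\<close> edges, one per player, turns a \<open>(2k-1)\<close>-spanner into a solution with the
  edges of \<open>\<Gamma>\<close> as coordinates. A star whose centre is blown up to \<open>s\<close> vertices gives \<open>N = n - s\<close>; a
  girth graph on about \<open>n / sqrt s\<close> vertices, each blown up to \<open>sqrt s\<close>, gives the other term.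

  The problem costs \<open>\<Omega>(s N)\<close> bits. A random set \<open>T\<close> of coordinates is held by nobody, and each
  other coordinate is held by each player independently with probability 1/3. A single coordinate
  \<open>e \<in> T\<close> is then planted with a single player \<open>i\<close>. Against player \<open>i\<close>, the others act as a
  second party that knows \<open>T\<close>, and only the planted input has \<open>e\<close> both in \<open>T\<close> and in \<open>X i\<close>. A
  history of channel \<open>i\<close> is a rectangle. A short channel reveals little about either side on inputs
  without a plant, so by the cut-and-paste identity for Hellinger distances it cannot reveal the
  plant either. The Hellinger distances, summed over all coordinates, are bounded by the entropy of
  the history through an entropy inequality on the cube.\<close>

section \<open>Expectations over random subsets\<close>

text \<open>For finite \<open>S\<close> and \<open>p\<close> in [0,1], the expectation of
  \<open>f X\<close> when \<open>X\<close> contains each element of \<open>S\<close> independently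
  with probability \<open>p\<close>. Written as a finite sum, it can be expanded one coordinate at a
  time, without integrability conditions.\<close>

definition rsub :: "real \<Rightarrow> 'a set \<Rightarrow> ('a set \<Rightarrow> real) \<Rightarrow> real" where
  "rsub p S f = (\<Sum>X\<in>Pow S. p ^ card X * (1 - p) ^ card (S - X) * f X)"

lemma rsub_empty [simp]: "rsub p {} f = f {}"
  by (simp add: rsub_def)

text \<open>Conditioning on the membership of \<open>e\<close>. This recursion drives the inductions
  over the ground set.\<close>

lemma rsub_insert:
  assumes "finite S" "e \<notin> S"
  shows "rsub p (insert e S) f = p * rsub p S (\<lambda>X. f (insert e X)) + (1 - p) * rsub p S f"
proof -
  have inj: "inj_on (insert e) (Pow S)"
    using assms(2) by (auto simp: inj_on_def)
  have disj: "Pow S \<inter> insert e ` Pow S = {}"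
    using assms(2) by auto
  have "rsub p (insert e S) f =
      (\<Sum>X\<in>Pow S. p ^ card X * (1 - p) ^ card (insert e S - X) * f X) +
      (\<Sum>X\<in>Pow S. p ^ card (insert e X) * (1 - p) ^ card (insert e S - insert e X) * f (insert e X))"
    unfolding rsub_def Pow_insert
    using assms disj inj by (simp add: sum.union_disjoint sum.reindex)
  also have "(\<Sum>X\<in>Pow S. p ^ card X * (1 - p) ^ card (insert e S - X) * f X) = (1 - p) * rsub p S f"
    unfolding rsub_def sum_distrib_left
  proof (rule sum.cong[OF refl])
    fix X assume X: "X \<in> Pow S"
    then have "insert e S - X = insert e (S - X)" using assms(2) by auto
    moreover have "finite (S - X)" "e \<notin> S - X" using assms by auto
    ultimately show "p ^ card X * (1 - p) ^ card (insert e S - X) * f X =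
        (1 - p) * (p ^ card X * (1 - p) ^ card (S - X) * f X)" by simp
  qed
  also have "(\<Sum>X\<in>Pow S. p ^ card (insert e X) * (1 - p) ^ card (insert e S - insert e X) * f (insert e X))
      = p * rsub p S (\<lambda>X. f (insert e X))"
    unfolding rsub_def sum_distrib_left
  proof (rule sum.cong[OF refl])
    fix X assume X: "X \<in> Pow S"
    then have "insert e S - insert e X = S - X" "e \<notin> X" "finite X"
      using assms by (auto intro: finite_subset)
    then show "p ^ card (insert e X) * (1 - p) ^ card (insert e S - insert e X) * f (insert e X) =
        p * (p ^ card X * (1 - p) ^ card (S - X) * f (insert e X))" by simp
  qed
  finally show ?thesis by simp
qed

lemma rsub_remove:
  assumes "finite S" "e \<in> S"
  shows "rsub p S f = p * rsub p (S - {e}) (\<lambda>X. f (insert e X)) + (1 - p) * rsub p (S - {e}) f"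
  using rsub_insert[of "S - {e}" e p f] assms by (simp add: insert_absorb)

lemma rsub_cong:
  assumes "\<And>X. X \<subseteq> S \<Longrightarrow> f X = g X"
  shows "rsub p S f = rsub p S g"
  unfolding rsub_def by (intro sum.cong) (use assms in auto)

lemma rsub_const [simp]: "finite S \<Longrightarrow> rsub p S (\<lambda>_. c) = c"
  by (induction S rule: finite_induct) (simp_all add: rsub_insert algebra_simps)

lemma rsub_add: "rsub p S (\<lambda>X. f X + g X) = rsub p S f + rsub p S g"
  by (simp add: rsub_def algebra_simps sum.distrib)

lemma rsub_diff: "rsub p S (\<lambda>X. f X - g X) = rsub p S f - rsub p S g"
  by (simp add: rsub_def algebra_simps sum_subtractf)

lemma rsub_cmult: "rsub p S (\<lambda>X. c * f X) = c * rsub p S f"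
  unfolding rsub_def sum_distrib_left by (intro sum.cong) (simp_all add: algebra_simps)

lemma rsub_multc: "rsub p S (\<lambda>X. f X * c) = rsub p S f * c"
  unfolding rsub_def sum_distrib_right by (intro sum.cong) (simp_all add: algebra_simps)

lemma rsub_sum: "rsub p S (\<lambda>X. \<Sum>i\<in>I. f i X) = (\<Sum>i\<in>I. rsub p S (f i))"
  unfolding rsub_def sum_distrib_left by (rule sum.swap)

lemma rsub_mono:
  assumes "0 \<le> p" "p \<le> 1" "\<And>X. X \<subseteq> S \<Longrightarrow> f X \<le> g X"
  shows "rsub p S f \<le> rsub p S g"
  unfolding rsub_def by (intro sum_mono mult_left_mono) (use assms in auto)

lemma rsub_nonneg:
  assumes "0 \<le> p" "p \<le> 1" "\<And>X. X \<subseteq> S \<Longrightarrow> 0 \<le> f X"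
  shows "0 \<le> rsub p S f"
  unfolding rsub_def by (intro sum_nonneg mult_nonneg_nonneg) (use assms in auto)

text \<open>The variance is nonnegative.\<close>

lemma rsub_power2_le:
  assumes "0 \<le> p" "p \<le> 1" "finite S"
  shows "(rsub p S f)\<^sup>2 \<le> rsub p S (\<lambda>X. (f X)\<^sup>2)"
proof -
  define m where "m = rsub p S f"
  have "0 \<le> rsub p S (\<lambda>X. (f X - m)\<^sup>2)"
    by (rule rsub_nonneg) (use assms in auto)
  also have "(\<lambda>X. (f X - m)\<^sup>2) = (\<lambda>X. ((f X)\<^sup>2 - (2 * m) * f X) + m\<^sup>2)"
    by (auto simp: power2_eq_square algebra_simps)
  also have "rsub p S \<dots> = rsub p S (\<lambda>X. (f X)\<^sup>2) - 2 * m * m + m\<^sup>2"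
    using assms(3) by (simp only: rsub_add rsub_diff rsub_cmult rsub_const m_def)
  finally show ?thesis
    by (simp add: m_def power2_eq_square)
qed

lemma rsub_Un:
  assumes "finite A" "finite B" "A \<inter> B = {}"
  shows "rsub p (A \<union> B) f = rsub p A (\<lambda>X. rsub p B (\<lambda>Y. f (X \<union> Y)))"
  using assms
proof (induction A arbitrary: f rule: finite_induct)
  case (insert a A)
  then have "rsub p (insert a A \<union> B) f =
      p * rsub p (A \<union> B) (\<lambda>X. f (insert a X)) + (1 - p) * rsub p (A \<union> B) f"
    by (simp add: rsub_insert)
  then show ?case
    using insert by (simp add: rsub_insert)
qed simp

lemma rsub_image:
  assumes "finite A" "inj_on g A"
  shows "rsub p (g ` A) f = rsub p A (\<lambda>X. f (g ` X))"
  using assms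
proof (induction A arbitrary: f rule: finite_induct)
  case (insert a A)
  then have "g a \<notin> g ` A" by auto
  then show ?case
    using insert by (simp add: rsub_insert)
qed simp

text \<open>For a single coordinate, both sides are the distribution on pairs (membership in \<open>X\<close>,
  membership in \<open>T\<close>) with weights 1/2 on (no, no) and 1/4 on each of (yes, no) and (no, yes).\<close>

lemma rsub_mixture:
  assumes "finite S"
  shows "rsub (1/4) S (\<lambda>T. rsub (1/3) (S - T) (\<lambda>X. f X T)) =
    rsub (1/2) S (\<lambda>D. rsub (1/2) D (\<lambda>T. rsub (1/2) (S - D) (\<lambda>X. f X T)))"
  using assms
proof (induction S arbitrary: f rule: finite_induct)
  case (insert e S)
  have fin: "finite X" if "X \<subseteq> S" for X
    using that insert.hyps(1) by (rule finite_subset)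
  have nin: "e \<notin> X" if "X \<subseteq> S" for X
    using that insert.hyps(2) by auto
  have diff: "insert e S - insert e X = S - X" "insert e S - X = insert e (S - X)" if "X \<subseteq> S" for X
    using that insert.hyps(2) by auto
  let ?I = "\<lambda>f. rsub (1/4) S (\<lambda>T. rsub (1/3) (S - T) (\<lambda>X. f X T))"
  let ?J = "\<lambda>f. rsub (1/2) S (\<lambda>D. rsub (1/2) D (\<lambda>T. rsub (1/2) (S - D) (\<lambda>X. f X T)))"
  let ?f1 = "\<lambda>X T. f X (insert e T)" and ?f2 = "\<lambda>X T. f (insert e X) T"
  have "rsub (1/4) (insert e S) (\<lambda>T. rsub (1/3) (insert e S - T) (\<lambda>X. f X T)) =
      1/4 * rsub (1/4) S (\<lambda>T. rsub (1/3) (insert e S - insert e T) (\<lambda>X. f X (insert e T))) +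
      3/4 * rsub (1/4) S (\<lambda>T. rsub (1/3) (insert e S - T) (\<lambda>X. f X T))"
    by (simp add: rsub_insert insert.hyps)
  also have "rsub (1/4) S (\<lambda>T. rsub (1/3) (insert e S - insert e T) (\<lambda>X. f X (insert e T))) = ?I ?f1"
    by (rule rsub_cong) (simp only: diff)
  also have "rsub (1/4) S (\<lambda>T. rsub (1/3) (insert e S - T) (\<lambda>X. f X T)) =
      rsub (1/4) S (\<lambda>T. 1/3 * rsub (1/3) (S - T) (\<lambda>X. ?f2 X T) + 2/3 * rsub (1/3) (S - T) (\<lambda>X. f X T))"
    by (rule rsub_cong) (simp add: diff rsub_insert insert.hyps)
  also have "\<dots> = 1/3 * ?I ?f2 + 2/3 * ?I f"
    by (simp only: rsub_add rsub_cmult)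
  \<comment> \<open>The new coordinate lies in \<open>T\<close> with probability 1/4, in
    \<open>X\<close> with probability 3/4 * 1/3 = 1/4, and in neither with probability 3/4 * 2/3 =
    1/2.\<close>
  finally have L: "rsub (1/4) (insert e S) (\<lambda>T. rsub (1/3) (insert e S - T) (\<lambda>X. f X T)) =
      1/4 * ?I ?f1 + 1/4 * ?I ?f2 + 1/2 * ?I f" by simp
  have "rsub (1/2) (insert e S) (\<lambda>D. rsub (1/2) D (\<lambda>T. rsub (1/2) (insert e S - D) (\<lambda>X. f X T))) =
      1/2 * rsub (1/2) S (\<lambda>D. rsub (1/2) (insert e D) (\<lambda>T. rsub (1/2) (insert e S - insert e D) (\<lambda>X. f X T))) +
      1/2 * rsub (1/2) S (\<lambda>D. rsub (1/2) D (\<lambda>T. rsub (1/2) (insert e S - D) (\<lambda>X. f X T)))"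
    by (simp add: rsub_insert insert.hyps)
  moreover have "rsub (1/2) S (\<lambda>D. rsub (1/2) (insert e D) (\<lambda>T. rsub (1/2) (insert e S - insert e D) (\<lambda>X. f X T))) =
      rsub (1/2) S (\<lambda>D. 1/2 * rsub (1/2) D (\<lambda>T. rsub (1/2) (S - D) (\<lambda>X. ?f1 X T)) +
         1/2 * rsub (1/2) D (\<lambda>T. rsub (1/2) (S - D) (\<lambda>X. f X T)))"
    by (rule rsub_cong) (simp add: diff rsub_insert fin nin)
  moreover have "\<dots> = 1/2 * ?J ?f1 + 1/2 * ?J f"
    by (simp only: rsub_add rsub_cmult)
  moreover have "rsub (1/2) S (\<lambda>D. rsub (1/2) D (\<lambda>T. rsub (1/2) (insert e S - D) (\<lambda>X. f X T))) =
      rsub (1/2) S (\<lambda>D. rsub (1/2) D (\<lambda>T. 1/2 * rsub (1/2) (S - D) (\<lambda>X. ?f2 X T) +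
         1/2 * rsub (1/2) (S - D) (\<lambda>X. f X T)))"
    by (rule rsub_cong) (simp add: diff rsub_insert insert.hyps)
  moreover have "\<dots> = 1/2 * ?J ?f2 + 1/2 * ?J f"
    by (simp only: rsub_add rsub_cmult)
  \<comment> \<open>Here a fair coin for \<open>D\<close> decides which of \<open>T\<close> and
    \<open>X\<close> may contain the coordinate, and a second fair coin decides whether it
    does.\<close>
  ultimately have R: "rsub (1/2) (insert e S) (\<lambda>D. rsub (1/2) D (\<lambda>T. rsub (1/2) (insert e S - D) (\<lambda>X. f X T))) =
      1/4 * ?J ?f1 + 1/4 * ?J ?f2 + 1/2 * ?J f" by linarith
  show ?case
    unfolding L R by (simp only: insert.IH)
qed simp

section \<open>The entropy inequality on the cube\<close>

text \<open>The one-dimensional case: the right side is four times the Jensen gap of x ln x at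
  \<open>u\<close> and \<open>v\<close>. Each of the two values is compared with the mean
  \<open>m\<close>, and what is left over is a perfect square.\<close>

lemma entropy_gap:
  fixes u v :: real
  assumes "0 \<le> u" "0 \<le> v"
  shows "(sqrt u - sqrt v)\<^sup>2 \<le> 4 * ((u * ln u + v * ln v) / 2 - (u + v) / 2 * ln ((u + v) / 2))"
proof -
  define m where "m = (u + v) / 2"
  \<comment> \<open>This is ln x \<le> x - 1 at x = sqrt (m / w), multiplied by 2w; for w = 0 both
    sides vanish.\<close>
  have *: "2 * w - 2 * sqrt w * sqrt m \<le> w * ln w - w * ln m" if "0 \<le> w" "0 < m" for w
  proof (cases "w = 0")
    case False
    then have w: "0 < w" using that by simp
    then have "ln (sqrt m / sqrt w) \<le> sqrt m / sqrt w - 1"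
      using that by (intro ln_le_minus_one) simp
    then have "ln m / 2 - ln w / 2 \<le> sqrt m / sqrt w - 1"
      using w that by (simp add: ln_div ln_sqrt)
    then have "2 * w * (ln m / 2 - ln w / 2) \<le> 2 * w * (sqrt m / sqrt w - 1)"
      using w by (intro mult_left_mono) auto
    also have "\<dots> = 2 * (sqrt w * sqrt w) * (sqrt m / sqrt w) - 2 * w"
      using w by (simp add: algebra_simps)
    also have "\<dots> = 2 * sqrt w * sqrt m - 2 * w"
      using w by (simp del: real_sqrt_mult_self abs_of_pos)
    finally show ?thesis by (simp add: algebra_simps)
  qed simp
  show ?thesis
  proof (cases "m = 0")
    case True
    then have "u = 0" "v = 0" using assms by (auto simp: m_def)
    then show ?thesis by simp
  next
    case False
    then have m: "0 < m" using assms by (auto simp: m_def)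
    define a b c where "a = sqrt u" and "b = sqrt v" and "c = sqrt m"
    have sq: "u = a\<^sup>2" "v = b\<^sup>2" "m = c\<^sup>2" using assms m by (auto simp: a_def b_def c_def)
    have "(2 * u - 2 * a * c) + (2 * v - 2 * b * c) \<le> u * ln u + v * ln v - (u + v) * ln m"
      using *[OF assms(1) m] *[OF assms(2) m] by (simp add: a_def b_def c_def algebra_simps)
    moreover have "2 * ((2 * u - 2 * a * c) + (2 * v - 2 * b * c)) \<ge> (a - b)\<^sup>2"
    proof -
      have "2 * c\<^sup>2 = a\<^sup>2 + b\<^sup>2" using sq by (simp add: m_def)
      then have "2 * ((2 * u - 2 * a * c) + (2 * v - 2 * b * c)) - (a - b)\<^sup>2 = (a + b - 2 * c)\<^sup>2"
        unfolding sq(1) sq(2) by (simp add: power2_eq_square algebra_simps)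
      then show ?thesis by (smt (verit) zero_le_power2)
    qed
    ultimately have "(a - b)\<^sup>2 \<le> 2 * (u * ln u + v * ln v - (u + v) * ln m)" by simp
    also have "\<dots> = 4 * ((u * ln u + v * ln v) / 2 - (u + v) / 2 * ln m)"
      by (simp add: algebra_simps add_divide_distrib)
    finally show ?thesis by (simp only: a_def b_def m_def)
  qed
qed

text \<open>Joint convexity of the squared Hellinger distance. After expansion of the squares it is
  the Cauchy-Schwarz inequality for (sqrt u, sqrt u') and (sqrt v, sqrt v').\<close>

lemma sqrt_diff_convex:
  fixes u v u' v' :: real
  assumes "0 \<le> u" "0 \<le> v" "0 \<le> u'" "0 \<le> v'"
  shows "(sqrt ((u + u') / 2) - sqrt ((v + v') / 2))\<^sup>2 \<le>
    ((sqrt u - sqrt v)\<^sup>2 + (sqrt u' - sqrt v')\<^sup>2) / 2"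
proof -
  have "(sqrt u * sqrt v + sqrt u' * sqrt v')\<^sup>2 \<le> (u + u') * (v + v')"
  proof -
    have "(u + u') * (v + v') - (sqrt u * sqrt v + sqrt u' * sqrt v')\<^sup>2 =
        (sqrt u * sqrt v' - sqrt u' * sqrt v)\<^sup>2"
      using assms by (simp add: power2_diff power2_sum power_mult_distrib algebra_simps)
    then show ?thesis by (smt (verit) zero_le_power2)
  qed
  then have "sqrt u * sqrt v + sqrt u' * sqrt v' \<le> sqrt ((u + u') * (v + v'))"
    using real_le_rsqrt by blast
  also have "\<dots> = 2 * (sqrt ((u + u') / 2) * sqrt ((v + v') / 2))"
    by (simp add: real_sqrt_mult real_sqrt_divide)
  finally show ?thesis
    using assms by (simp add: power2_diff field_simps)
qed

text \<open>Fixing the coordinate \<open>z\<close> splits \<open>f\<close> into two functions on a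
  smaller cube. The entropy of \<open>f\<close> is the average of their entropies plus the Jensen
  gap between their means: \<open>entropy_gap\<close> uses the gap to pay for \<open>z\<close>, and
  the induction hypothesis pays for the other coordinates.\<close>

lemma sum_sqrt_influence_le:
  fixes f :: "'a set \<Rightarrow> real"
  assumes "finite S" "\<And>X. X \<subseteq> S \<Longrightarrow> 0 \<le> f X"
  shows "(\<Sum>e\<in>S. (sqrt (rsub (1/2) (S - {e}) (\<lambda>X. f (insert e X))) - sqrt (rsub (1/2) (S - {e}) f))\<^sup>2)
    \<le> 4 * (rsub (1/2) S (\<lambda>X. f X * ln (f X)) - rsub (1/2) S f * ln (rsub (1/2) S f))"
  using assms
proof (induction S arbitrary: f rule: finite_induct)
  case (insert z S)
  let ?E = "\<lambda>A f. rsub (1/2) A f"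
  let ?g = "\<lambda>X. f (insert z X)"
  let ?d = "\<lambda>f e. (sqrt (?E (S - {e}) (\<lambda>X. f (insert e X))) - sqrt (?E (S - {e}) f))\<^sup>2"
  let ?ent = "\<lambda>f. ?E S (\<lambda>X. f X * ln (f X))"
  have pos: "0 \<le> f X" "0 \<le> ?g X" if "X \<subseteq> S" for X
    using that insert.prems by (auto intro: insert.prems)
  have split: "?E (insert z S) \<phi> = (?E S (\<lambda>X. \<phi> (insert z X)) + ?E S \<phi>) / 2" for \<phi>
    using insert.hyps by (simp add: rsub_insert)
  have z: "insert z S - {z} = S" using insert.hyps by auto
  \<comment> \<open>By convexity, averaging over the membership of \<open>z\<close> makes the
    influence of an old coordinate at most the average of its influences on the two halves.\<close>
  have "(\<Sum>e\<in>S. (sqrt (?E (insert z S - {e}) (\<lambda>X. f (insert e X))) - sqrt (?E (insert z S - {e}) f))\<^sup>2)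
      \<le> (\<Sum>e\<in>S. (?d ?g e + ?d f e) / 2)"
  proof (rule sum_mono)
    fix e assume e: "e \<in> S"
    then have 1: "insert z S - {e} = insert z (S - {e})" using insert.hyps by auto
    have 2: "?E (insert z S - {e}) \<phi> = (?E (S - {e}) (\<lambda>X. \<phi> (insert z X)) + ?E (S - {e}) \<phi>) / 2" for \<phi>
      unfolding 1 using insert.hyps by (simp add: rsub_insert)
    show "(sqrt (?E (insert z S - {e}) (\<lambda>X. f (insert e X))) - sqrt (?E (insert z S - {e}) f))\<^sup>2
        \<le> (?d ?g e + ?d f e) / 2"
      unfolding 2 insert_commute[of e z]
      by (rule sqrt_diff_convex; rule rsub_nonneg; (rule pos)?; use e in auto)
  qed
  also have "\<dots> = ((\<Sum>e\<in>S. ?d ?g e) + (\<Sum>e\<in>S. ?d f e)) / 2"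
    by (simp add: sum.distrib add_divide_distrib sum_divide_distrib)
  also have "\<dots> \<le> (4 * (?ent ?g - ?E S ?g * ln (?E S ?g)) + 4 * (?ent f - ?E S f * ln (?E S f))) / 2"
    using insert.IH[of f] insert.IH[of ?g] pos by auto
  finally have A: "(\<Sum>e\<in>S. (sqrt (?E (insert z S - {e}) (\<lambda>X. f (insert e X))) - sqrt (?E (insert z S - {e}) f))\<^sup>2)
      \<le> (4 * (?ent ?g - ?E S ?g * ln (?E S ?g)) + 4 * (?ent f - ?E S f * ln (?E S f))) / 2" .
  have B: "(sqrt (?E S ?g) - sqrt (?E S f))\<^sup>2 \<le> 4 * ((?E S ?g * ln (?E S ?g) + ?E S f * ln (?E S f)) / 2
      - (?E S ?g + ?E S f) / 2 * ln ((?E S ?g + ?E S f) / 2))"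
    by (rule entropy_gap; rule rsub_nonneg; (rule pos)?; simp)
  have "(\<Sum>e\<in>insert z S. (sqrt (?E (insert z S - {e}) (\<lambda>X. f (insert e X))) - sqrt (?E (insert z S - {e}) f))\<^sup>2)
      = (sqrt (?E S ?g) - sqrt (?E S f))\<^sup>2 +
        (\<Sum>e\<in>S. (sqrt (?E (insert z S - {e}) (\<lambda>X. f (insert e X))) - sqrt (?E (insert z S - {e}) f))\<^sup>2)"
    using insert.hyps z by simp
  also have "\<dots> \<le> 4 * ((?E S ?g * ln (?E S ?g) + ?E S f * ln (?E S f)) / 2
      - (?E S ?g + ?E S f) / 2 * ln ((?E S ?g + ?E S f) / 2)) +
      (4 * (?ent ?g - ?E S ?g * ln (?E S ?g)) + 4 * (?ent f - ?E S f * ln (?E S f))) / 2"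
    by (rule add_mono[OF B A])
  also have "\<dots> = 4 * ((?ent ?g + ?ent f) / 2 - (?E S ?g + ?E S f) / 2 * ln ((?E S ?g + ?E S f) / 2))"
    by (simp add: field_simps)
  finally show ?case unfolding split .
qed simp

section \<open>Two parties\<close>

text \<open>\<open>Fa h * Gb h\<close> is the probability of history \<open>h\<close> when the
  player is in state a and the others are in state b; the plant is (1,1). The left side compares
  (1,1) with (0,1), while the right side only involves the distances from (0,0) to (1,0) and to
  (0,1), neither of which needs the plant. Cauchy-Schwarz passes from variation to Hellinger
  distance.\<close>

lemma rectangle_variation_bound:
  fixes F0 F1 G0 G1 :: "'h \<Rightarrow> real"
  assumes nonneg: "\<And>h. h \<in> H \<Longrightarrow> 0 \<le> F0 h" "\<And>h. h \<in> H \<Longrightarrow> 0 \<le> F1 h"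
      "\<And>h. h \<in> H \<Longrightarrow> 0 \<le> G0 h" "\<And>h. h \<in> H \<Longrightarrow> 0 \<le> G1 h"
    and total: "(\<Sum>h\<in>H. F0 h * G0 h) = 1" "(\<Sum>h\<in>H. F1 h * G0 h) = 1"
      "(\<Sum>h\<in>H. F0 h * G1 h) = 1" "(\<Sum>h\<in>H. F1 h * G1 h) = 1"
  shows "(\<Sum>h\<in>H. \<bar>F1 h - F0 h\<bar> * G1 h)\<^sup>2 \<le>
    16 * (\<Sum>h\<in>H. G0 h * (sqrt (F1 h) - sqrt (F0 h))\<^sup>2) +
    24 * (\<Sum>h\<in>H. F0 h * (sqrt (G1 h) - sqrt (G0 h))\<^sup>2)"
proof -
  define f0 f1 g0 g1 where defs: "f0 h = sqrt (F0 h)" "f1 h = sqrt (F1 h)"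
      "g0 h = sqrt (G0 h)" "g1 h = sqrt (G1 h)" for h
  have sq: "F0 h = (f0 h)\<^sup>2" "F1 h = (f1 h)\<^sup>2" "G0 h = (g0 h)\<^sup>2" "G1 h = (g1 h)\<^sup>2"
    and pos: "0 \<le> f0 h" "0 \<le> f1 h" "0 \<le> g0 h" "0 \<le> g1 h" if "h \<in> H" for h
    using nonneg that by (auto simp: defs)
  let ?A = "\<Sum>h\<in>H. G0 h * (f1 h - f0 h)\<^sup>2" and ?B = "\<Sum>h\<in>H. F0 h * (g1 h - g0 h)\<^sup>2"
  let ?C = "\<Sum>h\<in>H. ((f1 h - f0 h) * g1 h)\<^sup>2"
  have "(\<Sum>h\<in>H. \<bar>F1 h - F0 h\<bar> * G1 h) = (\<Sum>h\<in>H. (\<bar>f1 h - f0 h\<bar> * g1 h) * ((f1 h + f0 h) * g1 h))"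
  proof (rule sum.cong[OF refl])
    fix h assume h: "h \<in> H"
    have "\<bar>F1 h - F0 h\<bar> = \<bar>f1 h - f0 h\<bar> * (f1 h + f0 h)"
      using pos[OF h] by (simp add: sq[OF h] power2_eq_square square_diff_square_factored abs_mult)
    then show "\<bar>F1 h - F0 h\<bar> * G1 h = (\<bar>f1 h - f0 h\<bar> * g1 h) * ((f1 h + f0 h) * g1 h)"
      by (simp add: sq(4)[OF h] power2_eq_square)
  qed
  then have "(\<Sum>h\<in>H. \<bar>F1 h - F0 h\<bar> * G1 h)\<^sup>2 \<le>
      (\<Sum>h\<in>H. (\<bar>f1 h - f0 h\<bar> * g1 h)\<^sup>2) * (\<Sum>h\<in>H. ((f1 h + f0 h) * g1 h)\<^sup>2)"
    by (simp only: Cauchy_Schwarz_ineq_sum)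
  also have "\<dots> = ?C * (\<Sum>h\<in>H. ((f1 h + f0 h) * g1 h)\<^sup>2)"
    by (simp add: power_mult_distrib)
  also have "\<dots> \<le> ?C * 4"
  proof (rule mult_left_mono)
    have "(\<Sum>h\<in>H. ((f1 h + f0 h) * g1 h)\<^sup>2) \<le> (\<Sum>h\<in>H. 2 * (F1 h * G1 h) + 2 * (F0 h * G1 h))"
    proof (rule sum_mono)
      fix h assume h: "h \<in> H"
      have "(f1 h + f0 h)\<^sup>2 \<le> 2 * (f1 h)\<^sup>2 + 2 * (f0 h)\<^sup>2"
        using zero_le_power2[of "f1 h - f0 h"] by (simp add: power2_sum power2_diff)
      then have "(f1 h + f0 h)\<^sup>2 * (g1 h)\<^sup>2 \<le> (2 * (f1 h)\<^sup>2 + 2 * (f0 h)\<^sup>2) * (g1 h)\<^sup>2"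
        by (rule mult_right_mono) simp
      then show "((f1 h + f0 h) * g1 h)\<^sup>2 \<le> 2 * (F1 h * G1 h) + 2 * (F0 h * G1 h)"
        unfolding power_mult_distrib sq[OF h] by (simp add: ring_distribs mult.assoc)
    qed
    also have "\<dots> = 4"
      by (simp add: sum.distrib sum_distrib_left[symmetric] total)
    finally show "(\<Sum>h\<in>H. ((f1 h + f0 h) * g1 h)\<^sup>2) \<le> 4" .
  qed (simp add: sum_nonneg)
  finally have 1: "(\<Sum>h\<in>H. \<bar>F1 h - F0 h\<bar> * G1 h)\<^sup>2 \<le> 4 * ?C" by simp
  have sum_sq: "(x + y)\<^sup>2 \<le> 2 * x\<^sup>2 + 2 * y\<^sup>2" for x y :: real
    using zero_le_power2[of "x - y"] by (simp add: power2_sum power2_diff)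
  let ?P = "\<Sum>h\<in>H. (f1 h * g1 h - f0 h * g0 h)\<^sup>2" and ?Q = "\<Sum>h\<in>H. (f1 h * g0 h - f0 h * g1 h)\<^sup>2"
  \<comment> \<open>From (1,1) to (0,1) by way of (0,0).\<close>
  have "?C \<le> (\<Sum>h\<in>H. 2 * (f1 h * g1 h - f0 h * g0 h)\<^sup>2 + 2 * (F0 h * (g1 h - g0 h)\<^sup>2))"
  proof (rule sum_mono)
    fix h assume h: "h \<in> H"
    have "(f1 h - f0 h) * g1 h = (f1 h * g1 h - f0 h * g0 h) + f0 h * (g0 h - g1 h)"
      by (simp add: algebra_simps)
    then have "((f1 h - f0 h) * g1 h)\<^sup>2 \<le>
        2 * (f1 h * g1 h - f0 h * g0 h)\<^sup>2 + 2 * (f0 h * (g0 h - g1 h))\<^sup>2"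
      using sum_sq by metis
    then show "((f1 h - f0 h) * g1 h)\<^sup>2 \<le>
        2 * (f1 h * g1 h - f0 h * g0 h)\<^sup>2 + 2 * (F0 h * (g1 h - g0 h)\<^sup>2)"
      by (simp add: sq(1)[OF h] power_mult_distrib power2_commute[of "g0 h"])
  qed
  then have 2: "?C \<le> 2 * ?P + 2 * ?B" by (simp add: sum.distrib sum_distrib_left)
  text \<open>Cut and paste: both affinities equal \<open>\<Sum>h. f0 h * f1 h * g0 h * g1 h\<close>.\<close>
  have "?P = (\<Sum>h\<in>H. F1 h * G1 h + F0 h * G0 h - 2 * (f0 h * f1 h * g0 h * g1 h))"
    by (rule sum.cong[OF refl]) (simp add: sq power2_eq_square algebra_simps)
  moreover have "?Q = (\<Sum>h\<in>H. F1 h * G0 h + F0 h * G1 h - 2 * (f0 h * f1 h * g0 h * g1 h))"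
    by (rule sum.cong[OF refl]) (simp add: sq power2_eq_square algebra_simps)
  ultimately have 3: "?P = ?Q"
    by (simp add: sum.distrib sum_subtractf total)
  \<comment> \<open>From (1,0) to (0,1), again by way of (0,0).\<close>
  have "?Q \<le> (\<Sum>h\<in>H. 2 * (G0 h * (f1 h - f0 h)\<^sup>2) + 2 * (F0 h * (g1 h - g0 h)\<^sup>2))"
  proof (rule sum_mono)
    fix h assume h: "h \<in> H"
    have "f1 h * g0 h - f0 h * g1 h = g0 h * (f1 h - f0 h) + f0 h * (g0 h - g1 h)"
      by (simp add: algebra_simps)
    then have "(f1 h * g0 h - f0 h * g1 h)\<^sup>2 \<le>
        2 * (g0 h * (f1 h - f0 h))\<^sup>2 + 2 * (f0 h * (g0 h - g1 h))\<^sup>2"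
      using sum_sq by metis
    then show "(f1 h * g0 h - f0 h * g1 h)\<^sup>2 \<le>
        2 * (G0 h * (f1 h - f0 h)\<^sup>2) + 2 * (F0 h * (g1 h - g0 h)\<^sup>2)"
      by (simp add: sq(1,3)[OF h] power_mult_distrib power2_commute[of "g0 h"])
  qed
  then have 4: "?Q \<le> 2 * ?A + 2 * ?B" by (simp add: sum.distrib sum_distrib_left)
  \<comment> \<open>4 * (2 * (2A + 2B) + 2B) = 16A + 24B.\<close>
  from 1 2 3 4 have "(\<Sum>h\<in>H. \<bar>F1 h - F0 h\<bar> * G1 h)\<^sup>2 \<le> 16 * ?A + 24 * ?B" by linarith
  then show ?thesis by (simp only: defs)
qed

text \<open>Entropy is at most the expected ideal code length for any subprobability
  \<open>q\<close>; pointwise this is ln x \<le> x - 1 at x = q h / p h.\<close>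

lemma gibbs_inequality:
  fixes p q :: "'h \<Rightarrow> real"
  assumes "\<And>h. h \<in> H \<Longrightarrow> 0 \<le> p h" "(\<Sum>h\<in>H. p h) = 1"
    and "\<And>h. h \<in> H \<Longrightarrow> 0 < q h" "(\<Sum>h\<in>H. q h) \<le> 1"
  shows "(\<Sum>h\<in>H. - (p h * ln (p h))) \<le> (\<Sum>h\<in>H. p h * ln (1 / q h))"
proof -
  have "(\<Sum>h\<in>H. - (p h * ln (p h)) - p h * ln (1 / q h)) \<le> (\<Sum>h\<in>H. q h - p h)"
  proof (rule sum_mono)
    fix h assume h: "h \<in> H"
    show "- (p h * ln (p h)) - p h * ln (1 / q h) \<le> q h - p h"
    proof (cases "p h = 0")
      case False
      then have p: "0 < p h" using assms(1)[OF h] by simp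
      note q = assms(3)[OF h]
      have "ln (q h / p h) \<le> q h / p h - 1"
        using p q by (intro ln_le_minus_one) simp
      then have "p h * ln (q h / p h) \<le> p h * (q h / p h - 1)"
        using p by (intro mult_left_mono) auto
      also have "\<dots> = q h - p h" using p by (simp add: field_simps)
      finally show ?thesis using p q by (simp add: ln_div algebra_simps)
    qed (use assms(3)[OF h] in simp)
  qed
  also have "\<dots> \<le> 0" using assms by (simp add: sum_subtractf)
  finally show ?thesis by (simp add: sum_subtractf)
qed

text \<open>For values in [0,1] every \<open>f X * ln (f X)\<close> is at most 0, so only the mean
  term of the entropy remains.\<close>

lemma sum_sqrt_influence_le_unit:
  fixes f :: "'a set \<Rightarrow> real"
  assumes "finite S" "\<And>X. X \<subseteq> S \<Longrightarrow> 0 \<le> f X" "\<And>X. X \<subseteq> S \<Longrightarrow> f X \<le> 1"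
  shows "(\<Sum>e\<in>S. (sqrt (rsub (1/2) (S - {e}) (\<lambda>X. f (insert e X))) - sqrt (rsub (1/2) (S - {e}) f))\<^sup>2)
    \<le> - 4 * (rsub (1/2) S f * ln (rsub (1/2) S f))"
proof -
  have "rsub (1/2) S (\<lambda>X. f X * ln (f X)) \<le> rsub (1/2) S (\<lambda>X. 0)"
  proof (rule rsub_mono)
    fix X assume "X \<subseteq> S"
    then have "0 \<le> f X" "f X \<le> 1" using assms by auto
    then show "f X * ln (f X) \<le> 0"
      by (cases "f X = 0") (auto intro: mult_nonneg_nonpos)
  qed auto
  then show ?thesis
    using sum_sqrt_influence_le[of S f] assms by simp
qed

text \<open>For fixed \<open>D\<close> the player's set is uniform below \<open>S - D\<close> and
  the others' set is uniform below \<open>D\<close>, independently, so the averaged history weights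
  \<open>A D h * B D h\<close> are still products. The cube inequality bounds the influences in both
  factors by the entropy of the history, and Gibbs' inequality bounds that by the expected ln (1 /
  q).\<close>

lemma two_party_information_bound:
  fixes a g :: "'h \<Rightarrow> 'a set \<Rightarrow> real" and q :: "'h \<Rightarrow> real"
  assumes fin: "finite S" "finite H"
    and a: "\<And>h X. X \<subseteq> S \<Longrightarrow> 0 \<le> a h X" "\<And>h X. X \<subseteq> S \<Longrightarrow> a h X \<le> 1"
    and g: "\<And>h T. T \<subseteq> S \<Longrightarrow> 0 \<le> g h T" "\<And>h T. T \<subseteq> S \<Longrightarrow> g h T \<le> 1"
    and total: "\<And>X T. X \<subseteq> S \<Longrightarrow> T \<subseteq> S \<Longrightarrow> (\<Sum>h\<in>H. a h X * g h T) = 1"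
    and q: "\<And>h. 0 < q h" "(\<Sum>h\<in>H. q h) \<le> 1"
  shows "(\<Sum>e\<in>S. rsub (1/2) (S - {e}) (\<lambda>D.
        (\<Sum>h\<in>H. \<bar>rsub (1/2) (S - {e} - D) (\<lambda>X. a h (insert e X)) - rsub (1/2) (S - {e} - D) (a h)\<bar>
          * rsub (1/2) D (\<lambda>T. g h (insert e T)))\<^sup>2))
    \<le> 192 * rsub (1/2) S (\<lambda>D.
        \<Sum>h\<in>H. rsub (1/2) (S - D) (a h) * rsub (1/2) D (g h) * ln (1 / q h))"
proof -
  let ?E = "\<lambda>A f. rsub (1/2) A f"
  have total': "(\<Sum>h\<in>H. ?E A (\<lambda>X. a h (\<phi> X)) * ?E B (\<lambda>T. g h (\<psi> T))) = 1"
    if "A \<subseteq> S" "B \<subseteq> S" "\<And>X. X \<subseteq> A \<Longrightarrow> \<phi> X \<subseteq> S" "\<And>T. T \<subseteq> B \<Longrightarrow> \<psi> T \<subseteq> S" for A B \<phi> \<psi>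
  proof -
    have "(\<Sum>h\<in>H. ?E A (\<lambda>X. a h (\<phi> X)) * ?E B (\<lambda>T. g h (\<psi> T))) =
        ?E A (\<lambda>X. ?E B (\<lambda>T. \<Sum>h\<in>H. a h (\<phi> X) * g h (\<psi> T)))"
      by (simp only: rsub_sum rsub_cmult rsub_multc)
    also have "\<dots> = ?E A (\<lambda>X. ?E B (\<lambda>T. 1))"
      by (intro rsub_cong total that)
    also have "\<dots> = 1"
      using that fin by (simp add: finite_subset)
    finally show ?thesis .
  qed
  define A where "A D h = ?E (S - D) (a h)" for D h
  define B where "B D h = ?E D (g h)" for D h
  define I where "I D e h = (sqrt (?E (S - D - {e}) (\<lambda>X. a h (insert e X))) - sqrt (?E (S - D - {e}) (a h)))\<^sup>2"
    for D e h
  define J where "J D e h = (sqrt (?E (D - {e}) (\<lambda>T. g h (insert e T))) - sqrt (?E (D - {e}) (g h)))\<^sup>2"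
    for D e h
  have A: "0 \<le> A D h" "A D h \<le> 1" and B: "0 \<le> B D h" "B D h \<le> 1" if "D \<subseteq> S" for D h
  proof -
    have D: "finite D" "finite (S - D)" using that fin by (auto intro: finite_subset)
    have sub: "X \<subseteq> S" if "X \<subseteq> S - D" for X using that by auto
    have sub': "X \<subseteq> S" if "X \<subseteq> D" for X using that \<open>D \<subseteq> S\<close> by auto
    show "0 \<le> A D h" "0 \<le> B D h"
      unfolding A_def B_def by (auto intro!: rsub_nonneg a g dest: sub sub')
    have "A D h \<le> ?E (S - D) (\<lambda>_. 1)" "B D h \<le> ?E D (\<lambda>_. 1)"
      unfolding A_def B_def by (auto intro!: rsub_mono a g dest: sub sub')
    then show "A D h \<le> 1" "B D h \<le> 1" using D by simp_all
  qed
  \<comment> \<open>Prescribing whether \<open>e\<close> is in \<open>D\<close> conditions on an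
    event of probability 1/2, hence the factor 2.\<close>
  have half: "?E (S - {e}) f = 2 * ?E S (\<lambda>D. if e \<in> D then 0 else f D)"
    "?E (S - {e}) (\<lambda>D. f (insert e D)) = 2 * ?E S (\<lambda>D. if e \<in> D then f D else 0)" if "e \<in> S" for e f
  proof -
    have *: "?E (S - {e}) (\<lambda>X. if e \<in> X then f1 X else f2 X) = ?E (S - {e}) f2" for f1 f2 :: "'a set \<Rightarrow> real"
      by (rule rsub_cong) auto
    show "?E (S - {e}) f = 2 * ?E S (\<lambda>D. if e \<in> D then 0 else f D)"
      "?E (S - {e}) (\<lambda>D. f (insert e D)) = 2 * ?E S (\<lambda>D. if e \<in> D then f D else 0)"
      using that fin by (simp_all add: rsub_remove[of S e] *)
  qed
  have "(\<Sum>e\<in>S. ?E (S - {e}) (\<lambda>D.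
        (\<Sum>h\<in>H. \<bar>?E (S - {e} - D) (\<lambda>X. a h (insert e X)) - ?E (S - {e} - D) (a h)\<bar>
          * ?E D (\<lambda>T. g h (insert e T)))\<^sup>2)) \<le>
      (\<Sum>e\<in>S. ?E (S - {e}) (\<lambda>D. 16 * (\<Sum>h\<in>H. B D h * I D e h) +
         24 * (\<Sum>h\<in>H. A (insert e D) h * J (insert e D) e h)))"
  proof (intro sum_mono rsub_mono)
    fix e D assume e: "e \<in> S" and D: "D \<subseteq> S - {e}"
    have 1: "S - insert e D = S - {e} - D" "S - D - {e} = S - {e} - D" "insert e D - {e} = D" using D by auto
    have sub: "insert e X \<subseteq> S" "X \<subseteq> S" if "X \<subseteq> S - {e} - D" for X using that e by auto
    have sub': "insert e X \<subseteq> S" "X \<subseteq> S" if "X \<subseteq> D" for X using that e D by auto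
    show "(\<Sum>h\<in>H. \<bar>?E (S - {e} - D) (\<lambda>X. a h (insert e X)) - ?E (S - {e} - D) (a h)\<bar>
          * ?E D (\<lambda>T. g h (insert e T)))\<^sup>2 \<le> 16 * (\<Sum>h\<in>H. B D h * I D e h) +
         24 * (\<Sum>h\<in>H. A (insert e D) h * J (insert e D) e h)"
      unfolding A_def B_def I_def J_def 1
      by (rule rectangle_variation_bound; (rule rsub_nonneg total')?)
        (use a g sub sub' D e in \<open>auto\<close>)
  qed auto
  \<comment> \<open>Both kinds of influence now refer to one random \<open>D\<close>: coordinates
    outside \<open>D\<close> count for the player, coordinates inside for the others.\<close>
  also have "\<dots> = (\<Sum>e\<in>S. 2 * ?E S (\<lambda>D. (if e \<in> D then 0 else 16 * (\<Sum>h\<in>H. B D h * I D e h)) +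
      (if e \<in> D then 24 * (\<Sum>h\<in>H. A D h * J D e h) else 0)))"
  proof (rule sum.cong[OF refl])
    fix e assume e: "e \<in> S"
    show "?E (S - {e}) (\<lambda>D. 16 * (\<Sum>h\<in>H. B D h * I D e h) +
         24 * (\<Sum>h\<in>H. A (insert e D) h * J (insert e D) e h)) =
       2 * ?E S (\<lambda>D. (if e \<in> D then 0 else 16 * (\<Sum>h\<in>H. B D h * I D e h)) +
      (if e \<in> D then 24 * (\<Sum>h\<in>H. A D h * J D e h) else 0))"
      unfolding rsub_add half(1)[OF e, of "\<lambda>D. 16 * (\<Sum>h\<in>H. B D h * I D e h)"]
        half(2)[OF e, of "\<lambda>D. 24 * (\<Sum>h\<in>H. A D h * J D e h)"] by simp
  qed
  also have "\<dots> = 2 * ?E S (\<lambda>D. \<Sum>e\<in>S. (if e \<in> D then 0 else 16 * (\<Sum>h\<in>H. B D h * I D e h)) +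
      (if e \<in> D then 24 * (\<Sum>h\<in>H. A D h * J D e h) else 0))"
    by (simp only: rsub_sum sum_distrib_left)
  also have "\<dots> \<le> 2 * ?E S (\<lambda>D. 96 * (\<Sum>h\<in>H. A D h * B D h * ln (1 / q h)))"
  proof (intro mult_left_mono rsub_mono)
    fix D assume D: "D \<subseteq> S"
    then have finD: "finite D" using fin by (auto intro: finite_subset)
    have "(\<Sum>e\<in>S. (if e \<in> D then 0 else 16 * (\<Sum>h\<in>H. B D h * I D e h)) +
        (if e \<in> D then 24 * (\<Sum>h\<in>H. A D h * J D e h) else 0)) =
      (\<Sum>e\<in>S - D. 16 * (\<Sum>h\<in>H. B D h * I D e h)) + (\<Sum>e\<in>D. 24 * (\<Sum>h\<in>H. A D h * J D e h))"
    proof -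
      have "S = (S - D) \<union> D" using D by auto
      then have "(\<Sum>e\<in>S. \<phi> e) = (\<Sum>e\<in>S - D. \<phi> e) + (\<Sum>e\<in>D. \<phi> e)" for \<phi> :: "'a \<Rightarrow> real"
        using fin finD sum.subset_diff[OF D] by simp
      then show ?thesis by simp
    qed
    also have "\<dots> = (\<Sum>h\<in>H. 16 * (B D h * (\<Sum>e\<in>S - D. I D e h)) + 24 * (A D h * (\<Sum>e\<in>D. J D e h)))"
      unfolding sum.distrib sum_distrib_left[symmetric]
      by (simp add: sum_distrib_left sum.swap[of _ _ H])
    \<comment> \<open>The coefficients are 16 * 4 = 64 for ln A and 24 * 4 = 96 for ln B. As ln A
      \<le> 0, the first may be raised to 96, and the logarithms combine to that of the
      product.\<close>
    also have "\<dots> \<le> (\<Sum>h\<in>H. 96 * - (A D h * B D h * ln (A D h * B D h)))"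
    proof (rule sum_mono)
      fix h assume h: "h \<in> H"
      have I: "(\<Sum>e\<in>S - D. I D e h) \<le> - 4 * (A D h * ln (A D h))"
        unfolding I_def A_def by (rule sum_sqrt_influence_le_unit) (use fin in \<open>auto intro!: a\<close>)
      have J: "(\<Sum>e\<in>D. J D e h) \<le> - 4 * (B D h * ln (B D h))"
        unfolding J_def B_def by (rule sum_sqrt_influence_le_unit) (use finD D in \<open>auto intro!: g\<close>)
      have "16 * (B D h * (\<Sum>e\<in>S - D. I D e h)) + 24 * (A D h * (\<Sum>e\<in>D. J D e h)) \<le>
          16 * (B D h * (- 4 * (A D h * ln (A D h)))) + 24 * (A D h * (- 4 * (B D h * ln (B D h))))"
        by (intro add_mono mult_left_mono I J A B D) auto
      also have "\<dots> \<le> 96 * - (A D h * B D h * ln (A D h * B D h))"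
      proof (cases "A D h = 0 \<or> B D h = 0")
        case False
        then have pos: "0 < A D h" "0 < B D h" using A(1)[OF D, of h] B(1)[OF D, of h] by auto
        have "A D h * B D h * ln (A D h) \<le> 0"
          using pos A(2)[OF D, of h] by (intro mult_nonneg_nonpos) auto
        then show ?thesis using pos A(2)[OF D, of h] by (simp add: ln_mult algebra_simps)
      qed auto
      finally show "16 * (B D h * (\<Sum>e\<in>S - D. I D e h)) + 24 * (A D h * (\<Sum>e\<in>D. J D e h)) \<le>
        96 * - (A D h * B D h * ln (A D h * B D h))" .
    qed
    also have "\<dots> = 96 * (\<Sum>h\<in>H. - (A D h * B D h * ln (A D h * B D h)))"
      by (simp only: sum_distrib_left)
    also have "\<dots> \<le> 96 * (\<Sum>h\<in>H. A D h * B D h * ln (1 / q h))"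
    proof (intro mult_left_mono gibbs_inequality)
      show "(\<Sum>h\<in>H. A D h * B D h) = 1"
        unfolding A_def B_def by (rule total') (use D in auto)
    qed (use A B D q in auto)
    finally show "(\<Sum>e\<in>S. (if e \<in> D then 0 else 16 * (\<Sum>h\<in>H. B D h * I D e h)) +
        (if e \<in> D then 24 * (\<Sum>h\<in>H. A D h * J D e h) else 0)) \<le>
      96 * (\<Sum>h\<in>H. A D h * B D h * ln (1 / q h))" .
  qed auto
  also have "\<dots> = 192 * ?E S (\<lambda>D. \<Sum>h\<in>H. A D h * B D h * ln (1 / q h))"
    by (simp only: rsub_cmult)
  finally show ?thesis unfolding A_def B_def .
qed

text \<open>The player with input \<open>X\<close> against all others, whose inputs are encoded by \<open>Y\<close>: the channel
  history \<open>hist X Y\<close> splits as a rectangle, and a claim may depend on the history and \<open>Y\<close> only.\<close>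

lemma planted_claim_bound:
  fixes hist :: "'a set \<Rightarrow> 'y set \<Rightarrow> 'h" and q :: "'h \<Rightarrow> real"
  assumes fin: "finite S" "finite V" and U: "\<And>T. U T \<subseteq> V"
    and rect: "\<And>X Y h. X \<subseteq> S \<Longrightarrow> Y \<subseteq> V \<Longrightarrow> hist X Y = h \<longleftrightarrow> \<alpha> h X \<and> \<beta> h Y"
    and claim: "\<And>e X Y. X \<subseteq> S \<Longrightarrow> Y \<subseteq> V \<Longrightarrow> claim e X Y \<longleftrightarrow> \<kappa> e (hist X Y) Y"
    and q: "\<And>h. 0 < q h" "\<And>H. finite H \<Longrightarrow> (\<Sum>h\<in>H. q h) \<le> 1"
  shows "(\<Sum>e\<in>S. (rsub (1/4) (S - {e}) (\<lambda>T. rsub (1/3) (S - {e} - T) (\<lambda>X.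
        rsub (1/3) (U (insert e T)) (\<lambda>Y. of_bool (claim e (insert e X) Y) - of_bool (claim e X Y)))))\<^sup>2)
    \<le> 192 * rsub (1/4) S (\<lambda>T. rsub (1/3) (S - T) (\<lambda>X. rsub (1/3) (U T) (\<lambda>Y. ln (1 / q (hist X Y)))))"
proof -
  define H where "H = (\<lambda>(X, Y). hist X Y) ` (Pow S \<times> Pow V)"
  have finH: "finite H" unfolding H_def using fin by auto
  have inH: "hist X Y \<in> H" if "X \<subseteq> S" "Y \<subseteq> V" for X Y
    unfolding H_def using that by force
  have finU: "finite (U T)" for T by (rule finite_subset[OF U fin(2)])
  define a :: "'h \<Rightarrow> 'a set \<Rightarrow> real" where "a h X = of_bool (\<alpha> h X)" for h X
  define g where "g h T = rsub (1/3) (U T) (\<lambda>Y. of_bool (\<beta> h Y))" for h T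
  \<comment> \<open>Exactly one history is compatible with both \<open>X\<close> and
    \<open>Y\<close>.\<close>
  have point: "(\<Sum>h\<in>H. a h X * (of_bool (\<beta> h Y) * w h)) = w (hist X Y)" if "X \<subseteq> S" "Y \<subseteq> V" for X Y w
  proof -
    have "(\<Sum>h\<in>H. a h X * (of_bool (\<beta> h Y) * w h)) = (\<Sum>h\<in>H. if h = hist X Y then w h else 0)"
    proof (rule sum.cong[OF refl])
      fix h
      show "a h X * (of_bool (\<beta> h Y) * w h) = (if h = hist X Y then w h else 0)"
        using rect[OF that, of h] by (cases "hist X Y = h") (auto simp: a_def)
    qed
    then show ?thesis using finH inH[OF that] by simp
  qed
  have spread: "rsub (1/3) (U T) (\<lambda>Y. w (hist X Y) Y) =
      (\<Sum>h\<in>H. a h X * rsub (1/3) (U T) (\<lambda>Y. of_bool (\<beta> h Y) * w h Y))" if "X \<subseteq> S" for X T w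
  proof -
    have "rsub (1/3) (U T) (\<lambda>Y. w (hist X Y) Y) =
        rsub (1/3) (U T) (\<lambda>Y. \<Sum>h\<in>H. a h X * (of_bool (\<beta> h Y) * w h Y))"
    proof (rule rsub_cong)
      fix Y assume "Y \<subseteq> U T"
      then have "Y \<subseteq> V" using U by blast
      then show "w (hist X Y) Y = (\<Sum>h\<in>H. a h X * (of_bool (\<beta> h Y) * w h Y))"
        using point[OF that, of Y "\<lambda>h. w h Y"] by simp
    qed
    also have "\<dots> = (\<Sum>h\<in>H. a h X * rsub (1/3) (U T) (\<lambda>Y. of_bool (\<beta> h Y) * w h Y))"
      by (simp only: rsub_sum rsub_cmult)
    finally show ?thesis .
  qed
  have a01: "0 \<le> a h X" "a h X \<le> 1" for h X by (auto simp: a_def)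
  have g0: "0 \<le> g h T" for h T unfolding g_def by (rule rsub_nonneg) auto
  have "g h T \<le> rsub (1/3) (U T) (\<lambda>_. 1)" for h T unfolding g_def by (rule rsub_mono) auto
  then have g1: "g h T \<le> 1" for h T using finU by simp
  have total: "(\<Sum>h\<in>H. a h X * g h T) = 1" if "X \<subseteq> S" for X T
    using spread[OF that, of T "\<lambda>_ _. 1"] finU by (simp add: g_def)
  let ?var = "\<lambda>e D. \<Sum>h\<in>H. \<bar>rsub (1/2) (S - {e} - D) (\<lambda>X. a h (insert e X)) - rsub (1/2) (S - {e} - D) (a h)\<bar>
          * rsub (1/2) D (\<lambda>T. g h (insert e T))"
  have "(\<Sum>e\<in>S. (rsub (1/4) (S - {e}) (\<lambda>T. rsub (1/3) (S - {e} - T) (\<lambda>X.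
        rsub (1/3) (U (insert e T)) (\<lambda>Y. of_bool (claim e (insert e X) Y) - of_bool (claim e X Y)))))\<^sup>2)
      \<le> (\<Sum>e\<in>S. rsub (1/2) (S - {e}) (\<lambda>D. (?var e D)\<^sup>2))"
  proof (rule sum_mono)
    fix e assume e: "e \<in> S"
    \<comment> \<open>The claim only thins out the others' factor: \<open>\<gamma> h T\<close> does
      not involve \<open>X\<close>, and it is dominated by \<open>g h (insert e T)\<close>. The
      effect of the plant therefore lies in the player's factor alone.\<close>
    define \<gamma> where "\<gamma> h T = rsub (1/3) (U (insert e T)) (\<lambda>Y. of_bool (\<beta> h Y) * of_bool (\<kappa> e h Y))" for h T
    have \<gamma>: "0 \<le> \<gamma> h T" "\<gamma> h T \<le> g h (insert e T)" for h T
      unfolding \<gamma>_def g_def by - (rule rsub_nonneg rsub_mono; auto)+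
    have inner: "rsub (1/3) (U (insert e T)) (\<lambda>Y. of_bool (claim e (insert e X) Y) - of_bool (claim e X Y))
        = (\<Sum>h\<in>H. (a h (insert e X) - a h X) * \<gamma> h T)" if "X \<subseteq> S" for X T
    proof -
      have *: "rsub (1/3) (U (insert e T)) (\<lambda>Y. of_bool (claim e Z Y)) = (\<Sum>h\<in>H. a h Z * \<gamma> h T)"
        if "Z \<subseteq> S" for Z
      proof -
        have "rsub (1/3) (U (insert e T)) (\<lambda>Y. of_bool (claim e Z Y)) =
            rsub (1/3) (U (insert e T)) (\<lambda>Y. of_bool (\<kappa> e (hist Z Y) Y))"
        proof (rule rsub_cong)
          fix Y assume "Y \<subseteq> U (insert e T)"
          then have "Y \<subseteq> V" using U by blast
          then show "of_bool (claim e Z Y) = (of_bool (\<kappa> e (hist Z Y) Y) :: real)"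
            by (simp only: claim[OF that])
        qed
        then show ?thesis
          using spread[OF that, of "insert e T" "\<lambda>h Y. of_bool (\<kappa> e h Y)"] by (simp add: \<gamma>_def)
      qed
      show ?thesis
        using that e by (simp add: rsub_diff * left_diff_distrib sum_subtractf)
    qed
    let ?d = "\<lambda>D. \<Sum>h\<in>H. (rsub (1/2) (S - {e} - D) (\<lambda>X. a h (insert e X)) - rsub (1/2) (S - {e} - D) (a h))
        * rsub (1/2) D (\<gamma> h)"
    have "rsub (1/4) (S - {e}) (\<lambda>T. rsub (1/3) (S - {e} - T) (\<lambda>X.
        rsub (1/3) (U (insert e T)) (\<lambda>Y. of_bool (claim e (insert e X) Y) - of_bool (claim e X Y)))) =
      rsub (1/4) (S - {e}) (\<lambda>T. rsub (1/3) (S - {e} - T) (\<lambda>X. \<Sum>h\<in>H. (a h (insert e X) - a h X) * \<gamma> h T))"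
      by (intro rsub_cong inner) auto
    \<comment> \<open>Given \<open>D\<close>, the sets \<open>X\<close> and \<open>T\<close> are
      independent, so the expectation of each product factors.\<close>
    also have "\<dots> = rsub (1/2) (S - {e}) ?d"
      by (subst rsub_mixture) (use fin in \<open>simp_all only: rsub_sum rsub_cmult rsub_multc rsub_diff finite_Diff\<close>)
    finally have eq: "rsub (1/4) (S - {e}) (\<lambda>T. rsub (1/3) (S - {e} - T) (\<lambda>X.
        rsub (1/3) (U (insert e T)) (\<lambda>Y. of_bool (claim e (insert e X) Y) - of_bool (claim e X Y)))) =
      rsub (1/2) (S - {e}) ?d" .
    have "(rsub (1/2) (S - {e}) ?d)\<^sup>2 \<le> rsub (1/2) (S - {e}) (\<lambda>D. (?d D)\<^sup>2)"
      by (rule rsub_power2_le) (use fin in auto)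
    also have "\<dots> \<le> rsub (1/2) (S - {e}) (\<lambda>D. (?var e D)\<^sup>2)"
    proof (rule rsub_mono)
      fix D
      have "\<bar>?d D\<bar> \<le> ?var e D"
      proof (rule order_trans[OF sum_abs], rule sum_mono)
        fix h
        have "0 \<le> rsub (1/2) D (\<gamma> h)" by (rule rsub_nonneg) (use \<gamma> in auto)
        moreover have "rsub (1/2) D (\<gamma> h) \<le> rsub (1/2) D (\<lambda>T. g h (insert e T))"
          by (rule rsub_mono) (use \<gamma> in auto)
        ultimately show "\<bar>(rsub (1/2) (S - {e} - D) (\<lambda>X. a h (insert e X)) - rsub (1/2) (S - {e} - D) (a h))
            * rsub (1/2) D (\<gamma> h)\<bar> \<le>
          \<bar>rsub (1/2) (S - {e} - D) (\<lambda>X. a h (insert e X)) - rsub (1/2) (S - {e} - D) (a h)\<bar>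
            * rsub (1/2) D (\<lambda>T. g h (insert e T))"
          by (simp add: abs_mult mult_left_mono)
      qed
      then show "(?d D)\<^sup>2 \<le> (?var e D)\<^sup>2"
        by (rule abs_le_square_iff[THEN iffD1, OF order_trans[OF _ abs_ge_self]])
    qed auto
    finally show "(rsub (1/4) (S - {e}) (\<lambda>T. rsub (1/3) (S - {e} - T) (\<lambda>X.
        rsub (1/3) (U (insert e T)) (\<lambda>Y. of_bool (claim e (insert e X) Y) - of_bool (claim e X Y)))))\<^sup>2
      \<le> rsub (1/2) (S - {e}) (\<lambda>D. (?var e D)\<^sup>2)" unfolding eq .
  qed
  also have "\<dots> \<le> 192 * rsub (1/2) S (\<lambda>D.
        \<Sum>h\<in>H. rsub (1/2) (S - D) (a h) * rsub (1/2) D (g h) * ln (1 / q h))"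
    by (rule two_party_information_bound) (use fin finH a01 g0 g1 total q in auto)
  also have "rsub (1/2) S (\<lambda>D. \<Sum>h\<in>H. rsub (1/2) (S - D) (a h) * rsub (1/2) D (g h) * ln (1 / q h)) =
      rsub (1/4) S (\<lambda>T. rsub (1/3) (S - T) (\<lambda>X. \<Sum>h\<in>H. a h X * g h T * ln (1 / q h)))"
    by (subst rsub_mixture) (use fin in \<open>simp_all only: rsub_sum rsub_cmult rsub_multc\<close>)
  also have "\<dots> = rsub (1/4) S (\<lambda>T. rsub (1/3) (S - T) (\<lambda>X. rsub (1/3) (U T) (\<lambda>Y. ln (1 / q (hist X Y)))))"
  proof (intro rsub_cong)
    fix T X assume "X \<subseteq> S - T"
    then have X: "X \<subseteq> S" by auto
    show "(\<Sum>h\<in>H. a h X * g h T * ln (1 / q h)) = rsub (1/3) (U T) (\<lambda>Y. ln (1 / q (hist X Y)))"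
      by (simp add: spread[OF X, of T "\<lambda>h _. ln (1 / q h)"] rsub_multc g_def mult.assoc)
  qed
  finally show ?thesis .
qed

section \<open>Channel histories\<close>

primrec hists :: "('p, 'o) coordinator \<Rightarrow> ('p, 'x) strategies \<Rightarrow> ('p \<Rightarrow> 'x) \<Rightarrow>
    ('p \<Rightarrow> event list) \<Rightarrow> 'p \<Rightarrow> event list" where
  "hists (Output y) \<sigma> x h = h"
| "hists (Send i b t) \<sigma> x h = hists t \<sigma> x (h(i := h i @ [To_Player b]))"
| "hists (Receive i t) \<sigma> x h =
     (let b = \<sigma> i (x i) (h i) in hists (t b) \<sigma> x (h(i := h i @ [From_Player b])))"

text \<open>Each step costs one bit and appends one event to the channel of one player in
  \<open>P\<close>.\<close>

lemma exec_bits_eq_sum_length_hists: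
  assumes "finite P" "players t \<subseteq> P"
  shows "snd (exec t \<sigma> x h) + (\<Sum>i\<in>P. length (h i)) = (\<Sum>i\<in>P. length (hists t \<sigma> x h i))"
proof -
  have upd: "(\<Sum>j\<in>P. length ((h(i := h i @ [c])) j)) = Suc (\<Sum>j\<in>P. length (h j))"
    if "i \<in> P" for i c and h :: "'a \<Rightarrow> event list"
  proof -
    have "(\<Sum>j\<in>P - {i}. length ((h(i := h i @ [c])) j)) = (\<Sum>j\<in>P - {i}. length (h j))"
      by (rule sum.cong) auto
    then show ?thesis using assms(1) that by (simp add: sum.remove)
  qed
  show ?thesis
    using assms(2)
  proof (induction t arbitrary: h)
    case (Send i b t)
    then have "i \<in> P" "players t \<subseteq> P" by auto
    then show ?case
      using Send.IH[of "h(i := h i @ [To_Player b])"] upd[of i h "To_Player b"]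
      by (simp del: fun_upd_apply)
  next
    case (Receive i t)
    define b where "b = \<sigma> i (x i) (h i)"
    have "i \<in> P" "players (t b) \<subseteq> P" using Receive.prems by auto
    then show ?case
      using Receive.IH[OF rangeI, of b "h(i := h i @ [From_Player b])"] upd[of i h "From_Player b"]
      by (simp add: Let_def b_def[symmetric] del: fun_upd_apply)
  qed simp
qed

text \<open>The player's side of the rectangle belonging to a history: \<open>r\<close> is its
  strategy with the input fixed, and only its own events are tested.\<close>

definition replies_match :: "(event list \<Rightarrow> bool) \<Rightarrow> event list \<Rightarrow> bool" where
  "replies_match r w \<longleftrightarrow> (\<forall>n<length w. \<forall>b. w ! n = From_Player b \<longrightarrow> r (take n w) = b)"

lemma replies_match_Nil [simp]: "replies_match r []"
  by (simp add: replies_match_def)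

lemma replies_match_snoc:
  "replies_match r (w @ [c]) \<longleftrightarrow> replies_match r w \<and> (\<forall>b. c = From_Player b \<longrightarrow> r w = b)"
  by (auto simp: replies_match_def nth_append less_Suc_eq)

lemma replies_match_appendD: "replies_match r (w @ v) \<Longrightarrow> replies_match r w"
  by (induction v rule: rev_induct) (auto simp: replies_match_snoc simp flip: append_assoc)

lemma hists_extends: "\<exists>v. hists t \<sigma> x h i = h i @ v"
proof (induction t arbitrary: h)
  case (Send j b t)
  define h' where "h' = h(j := h j @ [To_Player b])"
  obtain v where "hists t \<sigma> x h' i = h' i @ v" using Send.IH by blast
  moreover have "hists (Send j b t) \<sigma> x h = hists t \<sigma> x h'" by (simp add: h'_def del: fun_upd_apply)
  moreover have "h' i = h i @ (if i = j then [To_Player b] else [])" by (simp add: h'_def)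
  ultimately show ?case by (metis append_assoc)
next
  case (Receive j t)
  define b where "b = \<sigma> j (x j) (h j)"
  define h' where "h' = h(j := h j @ [From_Player b])"
  obtain v where "hists (t b) \<sigma> x h' i = h' i @ v" using Receive.IH[OF rangeI] by blast
  moreover have "hists (Receive j t) \<sigma> x h = hists (t b) \<sigma> x h'"
    by (simp add: h'_def b_def Let_def del: fun_upd_apply)
  moreover have "h' i = h i @ (if i = j then [From_Player b] else [])" by (simp add: h'_def)
  ultimately show ?case by (metis append_assoc)
qed simp

lemma replies_match_hists:
  "replies_match (\<sigma> i (x i)) (h i) \<Longrightarrow> replies_match (\<sigma> i (x i)) (hists t \<sigma> x h i)"
proof (induction t arbitrary: h)
  case (Send j b t)
  have "replies_match (\<sigma> i (x i)) ((h(j := h j @ [To_Player b])) i)"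
    using Send.prems by (auto simp: replies_match_snoc)
  then show ?case using Send.IH by (simp del: fun_upd_apply)
next
  case (Receive j t)
  define b where "b = \<sigma> j (x j) (h j)"
  have "replies_match (\<sigma> i (x i)) ((h(j := h j @ [From_Player b])) i)"
    using Receive.prems by (auto simp: replies_match_snoc b_def)
  then show ?case
    using Receive.IH[OF rangeI] by (simp add: Let_def b_def[symmetric] del: fun_upd_apply)
qed simp

text \<open>The rectangle property. If the new input would have given the same replies along the
  final history of channel \<open>i\<close>, the coordinator takes the same branches, and nobody
  else notices the replacement.\<close>

lemma exec_replace_input:
  assumes "replies_match (\<sigma> i z) (hists t \<sigma> x h i)"
  shows "exec t \<sigma> (x(i := z)) h = exec t \<sigma> x h \<and> hists t \<sigma> (x(i := z)) h = hists t \<sigma> x h"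
  using assms
proof (induction t arbitrary: h)
  case (Send j b t)
  then show ?case by (simp del: fun_upd_apply)
next
  case (Receive j t)
  define b where "b = \<sigma> j (x j) (h j)"
  define h' where "h' = h(j := h j @ [From_Player b])"
  have match: "replies_match (\<sigma> i z) (hists (t b) \<sigma> x h' i)"
    using Receive.prems by (simp add: Let_def b_def h'_def del: fun_upd_apply)
  \<comment> \<open>The history up to this reply is a prefix of the final one, so
    \<open>match\<close> already covers the reply.\<close>
  have b: "\<sigma> j ((x(i := z)) j) (h j) = b"
  proof (cases "j = i")
    case True
    obtain v where "hists (t b) \<sigma> x h' i = h' i @ v" using hists_extends[of "t b" \<sigma> x h' i] by blast
    then have "replies_match (\<sigma> i z) (h' i)"
      using match by (metis replies_match_appendD)
    then show ?thesis using True by (simp add: h'_def replies_match_snoc)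
  qed (simp add: b_def)
  show ?case
    using Receive.IH[OF rangeI match]
    by (simp only: exec.simps hists.simps Let_def b b_def[symmetric] h'_def[symmetric])
qed simp

text \<open>A channel may fall silent after any history, so histories do not form a prefix code; the
  weight 1/8 instead of 1/4 per event makes up for that.\<close>

lemma sum_history_weights_le_1:
  fixes H :: "event list set"
  assumes "finite H"
  shows "(\<Sum>h\<in>H. (1/8) ^ length h / 2) \<le> (1::real)"
proof -
  have "e \<in> {To_Player True, To_Player False, From_Player True, From_Player False}" for e
  proof (cases e)
    case (To_Player b)
    then show ?thesis by (cases b) auto
  next
    case (From_Player b)
    then show ?thesis by (cases b) auto
  qed
  then have UNIV: "(UNIV :: event set) = {To_Player True, To_Player False, From_Player True, From_Player False}"
    by blast
  have fin: "finite (UNIV :: event set)" and card: "card (UNIV :: event set) = 4"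
    unfolding UNIV by auto
  define L where "L = Max (insert 0 (length ` H))"
  let ?B = "\<lambda>n. {h :: event list. length h = n}"
  have finB: "finite (?B n)" and cardB: "card (?B n) = 4 ^ n" for n
    using finite_lists_length_eq[OF fin, of n] card_lists_length_eq[OF fin, of n] card by simp_all
  have "H \<subseteq> (\<Union>n\<in>{..L}. ?B n)"
    using assms by (auto simp: L_def)
  then have "(\<Sum>h\<in>H. (1/8) ^ length h / 2) \<le> (\<Sum>h\<in>(\<Union>n\<in>{..L}. ?B n). (1/8) ^ length h / (2::real))"
    by (intro sum_mono2) (use finB in auto)
  also have "\<dots> = (\<Sum>n\<le>L. \<Sum>h\<in>?B n. (1/8) ^ length h / 2)"
    by (rule sum.UNION_disjoint) (use finB in auto)
  \<comment> \<open>There are 4^n event lists of length n, of total weight (1/2)^(n+1); the halving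
    keeps the geometric sum below 1.\<close>
  also have "\<dots> = (\<Sum>n\<le>L. (1/2) ^ n / 2)"
  proof (rule sum.cong[OF refl])
    fix n
    have "(\<Sum>h\<in>?B n. (1/8) ^ length h / (2::real)) = 4 ^ n * ((1/8) ^ n / 2)"
      by (simp add: cardB)
    also have "\<dots> = (4 * (1/8)) ^ n / 2"
      by (subst power_mult_distrib) simp
    finally show "(\<Sum>h\<in>?B n. (1/8) ^ length h / (2::real)) = (1/2) ^ n / 2" by simp
  qed
  also have "\<dots> = 1 - (1/2) ^ Suc L"
    by (induction L) (simp_all add: field_simps)
  also have "\<dots> \<le> 1" by simp
  finally show ?thesis .
qed

lemma rsub_split_player:
  fixes f :: "(nat \<times> 'a) set \<Rightarrow> real"
  assumes "finite A" "i < s"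
  shows "rsub p ({..<s} \<times> A) f =
    rsub p A (\<lambda>X. rsub p (({..<s} - {i}) \<times> A) (\<lambda>Y. f (Pair i ` X \<union> Y)))"
proof -
  have "{..<s} \<times> A = Pair i ` A \<union> ({..<s} - {i}) \<times> A" using assms(2) by auto
  then have "rsub p ({..<s} \<times> A) f =
      rsub p (Pair i ` A) (\<lambda>X. rsub p (({..<s} - {i}) \<times> A) (\<lambda>Y. f (X \<union> Y)))"
    using assms(1) by (simp, subst rsub_Un) auto
  also have "\<dots> = rsub p A (\<lambda>X. rsub p (({..<s} - {i}) \<times> A) (\<lambda>Y. f (Pair i ` X \<union> Y)))"
    by (rule rsub_image) (use assms in \<open>auto simp: inj_on_def\<close>)
  finally show ?thesis .
qed

section \<open>From single channels to randomized protocols\<close>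

text \<open>The relation \<open>R\<close> holds all inputs at once; it is split into the row
  \<open>X\<close> of player \<open>i\<close> and the remaining rows \<open>Y\<close>. With the
  history weights as \<open>q\<close>, ln (1 / q) is linear in the length of the channel.\<close>

lemma player_claim_bound:
  fixes S :: "'a set" and enc :: "nat \<Rightarrow> 'a set \<Rightarrow> 'x" and claim :: "'o \<Rightarrow> nat \<Rightarrow> 'a \<Rightarrow> bool"
    and t :: "(nat, 'o) coordinator" and \<sigma> :: "(nat, 'x) strategies"
  defines "inp \<equiv> \<lambda>R j. enc j (R `` {j})"
  assumes fin: "finite S" and i: "i < s"
  shows "(\<Sum>e\<in>S. (rsub (1/4) (S - {e}) (\<lambda>T. rsub (1/3) ({..<s} \<times> (S - {e} - T)) (\<lambda>R.
      of_bool (claim (output_of (t, \<sigma>) (inp (insert (i, e) R))) i e) -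
      of_bool (claim (output_of (t, \<sigma>) (inp R)) i e))))\<^sup>2)
    \<le> 192 * rsub (1/4) S (\<lambda>T. rsub (1/3) ({..<s} \<times> (S - T)) (\<lambda>R.
        real (length (hists t \<sigma> (inp R) (\<lambda>_. []) i)) * ln 8 + ln 2))"
proof -
  define V where "V = ({..<s} - {i}) \<times> S"
  define U where "U T = ({..<s} - {i}) \<times> (S - T)" for T
  define comb where "comb X Y = Pair i ` X \<union> Y" for X :: "'a set" and Y :: "(nat \<times> 'a) set"
  define hist where "hist X Y = hists t \<sigma> (inp (comb X Y)) (\<lambda>_. []) i" for X Y
  define cl where "cl e X Y = claim (output_of (t, \<sigma>) (inp (comb X Y))) i e" for e X Y
  define \<alpha> where "\<alpha> h X = replies_match (\<sigma> i (enc i X)) h" for h X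
  \<comment> \<open>The witness \<open>X\<close> in \<open>\<beta>\<close> and
    \<open>\<kappa>\<close> is arbitrary: by \<open>paste\<close>, every input of player
    \<open>i\<close> that matches the history leads to the same history and the same claim.\<close>
  define \<beta> where "\<beta> h Y = (\<exists>X\<subseteq>S. hist X Y = h)" for h Y
  define \<kappa> where "\<kappa> e h Y = (\<exists>X\<subseteq>S. hist X Y = h \<and> cl e X Y)" for e h Y
  define q :: "event list \<Rightarrow> real" where "q h = (1/8) ^ length h / 2" for h
  have self: "inp (comb X Y) i = enc i X" if "Y \<subseteq> V" for X Y
  proof -
    have "comb X Y `` {i} = X" using that by (auto simp: comb_def V_def)
    then show ?thesis by (simp add: inp_def)
  qed
  have replace: "inp (comb X Y) = (inp (comb X' Y))(i := enc i X)" if "Y \<subseteq> V" for X X' Y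
  proof
    fix j
    have "comb X Y `` {j} = comb X' Y `` {j}" if "j \<noteq> i" using that by (auto simp: comb_def)
    then show "inp (comb X Y) j = ((inp (comb X' Y))(i := enc i X)) j"
      using self[OF that, of X] by (cases "j = i") (simp_all add: inp_def)
  qed
  have match: "\<alpha> (hist X Y) X" if "Y \<subseteq> V" for X Y
    using replies_match_hists[of \<sigma> i "inp (comb X Y)" "\<lambda>_. []" t] self[OF that]
    by (simp add: \<alpha>_def hist_def)
  have paste: "hist X Y = hist X' Y \<and> cl e X Y = cl e X' Y" if "Y \<subseteq> V" "\<alpha> (hist X' Y) X" for X X' Y e
    using exec_replace_input[of \<sigma> i "enc i X" t "inp (comb X' Y)" "\<lambda>_. []"] that
      replace[OF that(1), of X X']
    by (simp add: \<alpha>_def hist_def cl_def output_of_def)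
  have "(\<Sum>e\<in>S. (rsub (1/4) (S - {e}) (\<lambda>T. rsub (1/3) (S - {e} - T) (\<lambda>X.
        rsub (1/3) (U (insert e T)) (\<lambda>Y. of_bool (cl e (insert e X) Y) - of_bool (cl e X Y)))))\<^sup>2)
    \<le> 192 * rsub (1/4) S (\<lambda>T. rsub (1/3) (S - T) (\<lambda>X. rsub (1/3) (U T) (\<lambda>Y. ln (1 / q (hist X Y)))))"
  proof (rule planted_claim_bound[where V = V and \<alpha> = \<alpha> and \<beta> = \<beta> and \<kappa> = \<kappa>])
    show "finite V" unfolding V_def using fin by simp
    show "U T \<subseteq> V" for T unfolding U_def V_def by auto
    show "hist X Y = h \<longleftrightarrow> \<alpha> h X \<and> \<beta> h Y" if "X \<subseteq> S" "Y \<subseteq> V" for X Y h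
      using that match paste unfolding \<beta>_def by metis
    show "cl e X Y \<longleftrightarrow> \<kappa> e (hist X Y) Y" if "X \<subseteq> S" "Y \<subseteq> V" for e X Y
      using that match paste unfolding \<kappa>_def by metis
    show "(\<Sum>h\<in>H. q h) \<le> 1" if "finite H" for H
      using sum_history_weights_le_1[OF that] by (simp add: q_def)
  qed (use fin in \<open>auto simp: q_def\<close>)
  moreover have "rsub (1/3) ({..<s} \<times> (S - {e} - T)) (\<lambda>R.
      of_bool (claim (output_of (t, \<sigma>) (inp (insert (i, e) R))) i e) -
      of_bool (claim (output_of (t, \<sigma>) (inp R)) i e)) =
    rsub (1/3) (S - {e} - T) (\<lambda>X.
        rsub (1/3) (U (insert e T)) (\<lambda>Y. of_bool (cl e (insert e X) Y) - of_bool (cl e X Y)))" for e T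
  proof -
    have "S - {e} - T = S - insert e T" by auto
    then show ?thesis
      unfolding rsub_split_player[OF finite_Diff[OF finite_Diff[OF fin]] i] U_def cl_def comb_def
      by simp
  qed
  moreover have "rsub (1/3) ({..<s} \<times> (S - T)) (\<lambda>R.
        real (length (hists t \<sigma> (inp R) (\<lambda>_. []) i)) * ln 8 + ln 2) =
      rsub (1/3) (S - T) (\<lambda>X. rsub (1/3) (U T) (\<lambda>Y. ln (1 / q (hist X Y))))" for T
  proof -
    have "ln (1 / q h) = real (length h) * ln 8 + ln 2" for h
      by (simp add: q_def ln_div ln_mult ln_realpow power_divide)
    then show ?thesis
      unfolding rsub_split_player[OF finite_Diff[OF fin] i] U_def hist_def comb_def by simp
  qed
  ultimately show ?thesis by simp
qed

text \<open>The channel lengths add up to the bits exchanged, which bounds the sum of the squared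
  advantages over all players and coordinates. Cauchy-Schwarz over the s * card S pairs gives the
  square of the sum.\<close>

lemma deterministic_claim_bound:
  fixes S :: "'a set" and enc :: "nat \<Rightarrow> 'a set \<Rightarrow> 'x" and claim :: "'o \<Rightarrow> nat \<Rightarrow> 'a \<Rightarrow> bool"
    and \<pi> :: "(nat, 'x, 'o) protocol"
  defines "inp \<equiv> \<lambda>R j. enc j (R `` {j})"
  assumes fin: "finite S" and players: "players (fst \<pi>) \<subseteq> {..<s}"
    and bits: "\<And>R. R \<subseteq> {..<s} \<times> S \<Longrightarrow> real (bits_of \<pi> (inp R)) \<le> C"
  shows "(\<Sum>i<s. \<Sum>e\<in>S. rsub (1/4) (S - {e}) (\<lambda>T. rsub (1/3) ({..<s} \<times> (S - {e} - T)) (\<lambda>R.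
      of_bool (claim (output_of \<pi> (inp (insert (i, e) R))) i e) -
      of_bool (claim (output_of \<pi> (inp R)) i e))))\<^sup>2
    \<le> real s * real (card S) * (192 * (C * ln 8 + real s * ln 2))"
proof -
  obtain t \<sigma> where \<pi>: "\<pi> = (t, \<sigma>)" by (cases \<pi>)
  define d where "d i e = rsub (1/4) (S - {e}) (\<lambda>T. rsub (1/3) ({..<s} \<times> (S - {e} - T)) (\<lambda>R.
      of_bool (claim (output_of (t, \<sigma>) (inp (insert (i, e) R))) i e) -
      of_bool (claim (output_of (t, \<sigma>) (inp R)) i e)))" for i e
  let ?len = "\<lambda>R i. real (length (hists t \<sigma> (inp R) (\<lambda>_. []) i))"
  have "(\<Sum>i<s. \<Sum>e\<in>S. (d i e)\<^sup>2) \<le>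
      (\<Sum>i<s. 192 * rsub (1/4) S (\<lambda>T. rsub (1/3) ({..<s} \<times> (S - T)) (\<lambda>R. ?len R i * ln 8 + ln 2)))"
    unfolding d_def inp_def by (intro sum_mono player_claim_bound fin) auto
  also have "\<dots> = 192 * rsub (1/4) S (\<lambda>T. rsub (1/3) ({..<s} \<times> (S - T)) (\<lambda>R. \<Sum>i<s. ?len R i * ln 8 + ln 2))"
    by (simp only: rsub_sum sum_distrib_left)
  also have "\<dots> \<le> 192 * rsub (1/4) S (\<lambda>T. rsub (1/3) ({..<s} \<times> (S - T)) (\<lambda>R. C * ln 8 + real s * ln 2))"
  proof (intro mult_left_mono rsub_mono)
    fix T R assume "R \<subseteq> {..<s} \<times> (S - T)"
    then have R: "R \<subseteq> {..<s} \<times> S" by auto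
    have "bits_of \<pi> (inp R) = (\<Sum>i<s. length (hists t \<sigma> (inp R) (\<lambda>_. []) i))"
      using exec_bits_eq_sum_length_hists[of "{..<s}" t \<sigma> "inp R" "\<lambda>_. []"] players
      by (simp add: \<pi> bits_of_def)
    then have "(\<Sum>i<s. ?len R i) \<le> C" using bits[OF R] by simp
    then have "(\<Sum>i<s. ?len R i) * ln 8 \<le> C * ln 8" by (intro mult_right_mono) auto
    then show "(\<Sum>i<s. ?len R i * ln 8 + ln 2) \<le> C * ln 8 + real s * ln 2"
      by (simp add: sum.distrib sum_distrib_right)
  qed auto
  also have "\<dots> = 192 * (C * ln 8 + real s * ln 2)"
    using fin by simp
  finally have *: "(\<Sum>i<s. \<Sum>e\<in>S. (d i e)\<^sup>2) \<le> 192 * (C * ln 8 + real s * ln 2)" .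
  have "(\<Sum>i<s. \<Sum>e\<in>S. d i e)\<^sup>2 = (\<Sum>(i, e)\<in>{..<s} \<times> S. d i e)\<^sup>2"
    by (simp add: sum.cartesian_product)
  also have "\<dots> \<le> (\<Sum>z\<in>{..<s} \<times> S. (case z of (i, e) \<Rightarrow> d i e)\<^sup>2) * real (card ({..<s} \<times> S))"
    by (rule sum_squared_le_sum_of_squares)
  also have "(\<Sum>z\<in>{..<s} \<times> S. (case z of (i, e) \<Rightarrow> d i e)\<^sup>2) = (\<Sum>i<s. \<Sum>e\<in>S. (d i e)\<^sup>2)"
    by (simp add: sum.cartesian_product case_prod_unfold)
  also have "(\<Sum>i<s. \<Sum>e\<in>S. (d i e)\<^sup>2) * real (card ({..<s} \<times> S)) \<le>
      192 * (C * ln 8 + real s * ln 2) * real (card ({..<s} \<times> S))"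
    by (rule mult_right_mono[OF *]) simp
  finally show ?thesis
    unfolding \<pi> d_def by (simp add: card_cartesian_product mult_ac)
qed

lemma expectation_rsub:
  fixes f :: "'a set \<Rightarrow> 'b \<Rightarrow> real"
  assumes "\<And>X. integrable M (f X)"
  shows "integrable M (\<lambda>\<pi>. rsub p S (\<lambda>X. f X \<pi>))"
    and "(\<integral>\<pi>. rsub p S (\<lambda>X. f X \<pi>) \<partial>M) = rsub p S (\<lambda>X. \<integral>\<pi>. f X \<pi> \<partial>M)"
  unfolding rsub_def using assms by simp_all

text \<open>The average over the planted instances of (probability to be correct on the planted input)
  + (probability to be correct without the plant) - 1 is at least 1/3, hence so it is for some
  deterministic protocol.\<close>

lemma randomized_claim_bound:
  fixes S :: "'a set" and enc :: "nat \<Rightarrow> 'a set \<Rightarrow> 'x" and claim :: "'o \<Rightarrow> nat \<Rightarrow> 'a \<Rightarrow> bool"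
    and \<R> :: "(nat, 'x, 'o) protocol pmf"
  defines "inp \<equiv> \<lambda>R j. enc j (R `` {j})"
  assumes fin: "finite S" and solves: "solves {..<s} I correct \<R>"
    and inp: "\<And>R. R \<subseteq> {..<s} \<times> S \<Longrightarrow> inp R \<in> I"
    and planted: "\<And>i e R y. i < s \<Longrightarrow> e \<in> S \<Longrightarrow> R \<subseteq> {..<s} \<times> (S - {e}) \<Longrightarrow>
      correct (inp (insert (i, e) R)) y \<Longrightarrow> claim y i e"
    and unplanted: "\<And>i e R y. i < s \<Longrightarrow> e \<in> S \<Longrightarrow> R \<subseteq> {..<s} \<times> (S - {e}) \<Longrightarrow>
      correct (inp R) y \<Longrightarrow> \<not> claim y i e"
    and bits: "\<And>\<pi> x. \<pi> \<in> set_pmf \<R> \<Longrightarrow> x \<in> I \<Longrightarrow> real (bits_of \<pi> x) \<le> C"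
    and pos: "0 < s" "S \<noteq> {}"
  shows "real s * real (card S) \<le> 1728 * (C * ln 8 + real s * ln 2)"
proof -
  define corr :: "(nat \<times> 'a) set \<Rightarrow> (nat, 'x, 'o) protocol \<Rightarrow> real"
    where "corr R \<pi> = of_bool (correct (inp R) (output_of \<pi> (inp R)))" for R \<pi>
  define Z where "Z \<pi> = (\<Sum>i<s. \<Sum>e\<in>S. rsub (1/4) (S - {e}) (\<lambda>T.
      rsub (1/3) ({..<s} \<times> (S - {e} - T)) (\<lambda>R. corr (insert (i, e) R) \<pi> + corr R \<pi> - 1)))" for \<pi>
  have int_corr: "integrable (measure_pmf \<R>) (corr R)" for R
    by (rule measure_pmf.integrable_const_bound[where B = 1]) (auto simp: corr_def)
  have int: "integrable (measure_pmf \<R>) (\<lambda>\<pi>. corr (insert (i, e) R) \<pi> + corr R \<pi> - 1)" for i e R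
    using int_corr by simp
  have ex_corr: "2/3 \<le> measure_pmf.expectation \<R> (corr R)" if "R \<subseteq> {..<s} \<times> S" for R
  proof -
    have "measure_pmf.expectation \<R> (corr R) =
        measure_pmf.prob \<R> {\<pi>. correct (inp R) (output_of \<pi> (inp R))}"
    proof -
      have "corr R = indicator {\<pi>. correct (inp R) (output_of \<pi> (inp R))}"
        by (auto simp: corr_def indicator_def fun_eq_iff)
      then show ?thesis by simp
    qed
    then show ?thesis using solves inp[OF that] by (auto simp: solves_def)
  qed
  have int_Z: "integrable (measure_pmf \<R>) Z"
    unfolding Z_def by (intro Bochner_Integration.integrable_sum expectation_rsub int)
  have "real s * real (card S) / 3 = (\<Sum>i<s. \<Sum>e\<in>S. rsub (1/4) (S - {e}) (\<lambda>T.
      rsub (1/3) ({..<s} \<times> (S - {e} - T)) (\<lambda>R. 1/3)))"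
    using fin by simp
  also have "\<dots> \<le> (\<Sum>i<s. \<Sum>e\<in>S. rsub (1/4) (S - {e}) (\<lambda>T.
      rsub (1/3) ({..<s} \<times> (S - {e} - T)) (\<lambda>R.
        measure_pmf.expectation \<R> (\<lambda>\<pi>. corr (insert (i, e) R) \<pi> + corr R \<pi> - 1))))"
  proof (intro sum_mono rsub_mono)
    fix i e T R assume "i \<in> {..<s}" "e \<in> S" "R \<subseteq> {..<s} \<times> (S - {e} - T)"
    then have "insert (i, e) R \<subseteq> {..<s} \<times> S" "R \<subseteq> {..<s} \<times> S" by auto
    then show "1/3 \<le> measure_pmf.expectation \<R> (\<lambda>\<pi>. corr (insert (i, e) R) \<pi> + corr R \<pi> - 1)"
      using ex_corr[of "insert (i, e) R"] ex_corr[of R] int_corr by simp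
  qed auto
  also have "\<dots> = measure_pmf.expectation \<R> Z"
    unfolding Z_def
    by (simp add: Bochner_Integration.integral_sum Bochner_Integration.integrable_sum expectation_rsub int)
  finally have "real s * real (card S) / 3 \<le> measure_pmf.expectation \<R> Z" .
  moreover have "measure_pmf.expectation \<R> Z < real s * real (card S) / 3"
    if "\<And>\<pi>. \<pi> \<in> set_pmf \<R> \<Longrightarrow> Z \<pi> < real s * real (card S) / 3"
    by (rule measure_pmf.expectation_less[OF int_Z]) (use that in \<open>auto simp: AE_measure_pmf_iff\<close>)
  ultimately obtain \<pi> where \<pi>: "\<pi> \<in> set_pmf \<R>" "real s * real (card S) / 3 \<le> Z \<pi>"
    by (meson not_less)
  define D where "D = (\<Sum>i<s. \<Sum>e\<in>S. rsub (1/4) (S - {e}) (\<lambda>T. rsub (1/3) ({..<s} \<times> (S - {e} - T)) (\<lambda>R.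
      of_bool (claim (output_of \<pi> (inp (insert (i, e) R))) i e) -
      (of_bool (claim (output_of \<pi> (inp R)) i e) :: real))))"
  \<comment> \<open>If both runs are correct, the claim is made with the plant only and the
    difference is 1. One correct run still makes the difference nonnegative, and otherwise -1 is a
    trivial lower bound.\<close>
  have "Z \<pi> \<le> D"
    unfolding Z_def D_def
  proof (intro sum_mono rsub_mono)
    fix i e T R assume "i \<in> {..<s}" "e \<in> S" "R \<subseteq> {..<s} \<times> (S - {e} - T)"
    then have "i < s" "e \<in> S" "R \<subseteq> {..<s} \<times> (S - {e})" by auto
    then show "corr (insert (i, e) R) \<pi> + corr R \<pi> - 1 \<le>
        of_bool (claim (output_of \<pi> (inp (insert (i, e) R))) i e) -
        of_bool (claim (output_of \<pi> (inp R)) i e)"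
      using planted[of i e R] unplanted[of i e R] by (auto simp: corr_def)
  qed auto
  then have D: "real s * real (card S) / 3 \<le> D" using \<pi> by simp
  have "D\<^sup>2 \<le> real s * real (card S) * (192 * (C * ln 8 + real s * ln 2))"
    unfolding D_def inp_def
  proof (rule deterministic_claim_bound[OF fin])
    show "players (fst \<pi>) \<subseteq> {..<s}" using solves \<pi>(1) by (auto simp: solves_def)
  qed (use bits \<pi>(1) inp in \<open>auto simp: inp_def\<close>)
  moreover have "(real s * real (card S) / 3)\<^sup>2 \<le> D\<^sup>2"
    using D by (intro power_mono) auto
  \<comment> \<open>One factor s * card S cancels; the square of 1/3 accounts for 1728 = 9 *
    192.\<close>
  ultimately have "(real s * real (card S)) * (real s * real (card S) / 9) \<le>
      (real s * real (card S)) * (192 * (C * ln 8 + real s * ln 2))"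
    by (simp add: power2_eq_square)
  moreover have "0 < real s * real (card S)" using pos fin by (simp add: card_gt_0_iff)
  ultimately have "real s * real (card S) / 9 \<le> 192 * (C * ln 8 + real s * ln 2)"
    using mult_le_cancel_left_pos by blast
  then show ?thesis by simp
qed

section \<open>Spanners of blown-up graphs\<close>

lemma relpow_map:
  assumes "\<And>x y. (x, y) \<in> A \<Longrightarrow> (\<phi> x, \<phi> y) \<in> B" "(u, v) \<in> A ^^ m"
  shows "(\<phi> u, \<phi> v) \<in> B ^^ m"
  using assms(2) by (induction m arbitrary: v) (auto dest: assms(1))

text \<open>A shortest walk from \<open>a\<close> to \<open>b\<close> repeats no vertex, and it has
  at least two steps because \<open>a\<close> and \<open>b\<close> are distinct and not adjacent in
  \<open>G\<close>. Adding the edge between them thus yields a cycle on at least three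
  vertices.\<close>

lemma walk_closes_to_cycle:
  assumes walk: "(a, b) \<in> adjacency G ^^ m" and "a \<noteq> b" "{a, b} \<notin> G"
  shows "\<exists>xs. is_cycle (insert {a, b} G) xs \<and> length xs \<le> Suc m"
proof -
  let ?R = "adjacency G"
  define n where "n = (LEAST n. (a, b) \<in> ?R ^^ n)"
  have n: "(a, b) \<in> ?R ^^ n" and n_le: "n \<le> m" and least: "\<And>l. (a, b) \<in> ?R ^^ l \<Longrightarrow> n \<le> l"
    unfolding n_def using walk by (auto intro: LeastI Least_le)
  obtain f where f: "f 0 = a" "f n = b" "\<And>i. i < n \<Longrightarrow> (f i, f (Suc i)) \<in> ?R"
    using n unfolding relpow_fun_conv by blast
  have seg: "(f i, f (i + l)) \<in> ?R ^^ l" if "i + l \<le> n" for i l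
    using that
  proof (induction l)
    case (Suc l)
    then show ?case using f(3)[of "i + l"] by (auto intro: relcompI)
  qed simp
  \<comment> \<open>Cutting out the part between two visits to a vertex would give a shorter
    walk.\<close>
  have inj: "f i \<noteq> f j" if "i < j" "j \<le> n" for i j
  proof
    assume eq: "f i = f j"
    have "(a, f i) \<in> ?R ^^ i" "(f j, b) \<in> ?R ^^ (n - j)"
      using seg[of 0 i] seg[of j "n - j"] that f by auto
    then have "(a, b) \<in> ?R ^^ (i + (n - j))"
      unfolding relpow_add using eq by auto
    then show False using least[of "i + (n - j)"] that by simp
  qed
  have "n \<noteq> 0" using f(1,2) \<open>a \<noteq> b\<close> by metis
  moreover have "n \<noteq> 1" using f(1,2) f(3)[of 0] assms(3) by (auto simp: adjacency_def)
  ultimately have n2: "2 \<le> n" by simp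
  let ?xs = "map f [0..<Suc n]"
  have nth: "?xs ! i = f i" if "i \<le> n" for i using that by (simp add: nth_append less_Suc_eq_le del: upt_Suc)
  have "distinct ?xs"
    unfolding distinct_map using inj by (auto simp: inj_on_def) (metis less_Suc_eq_le nat_neq_iff less_imp_le order_refl)+
  moreover have "{?xs ! i, ?xs ! (Suc i mod Suc n)} \<in> insert {a, b} G" if "i < Suc n" for i
  proof (cases "i = n")
    case True
    then show ?thesis using nth[of n] nth[of 0] f by (auto simp: insert_commute simp del: upt_Suc)
  next
    case False
    then have i: "i < n" using that by simp
    then show ?thesis
      using nth[of i] nth[of "Suc i"] f(3)[OF i] by (simp add: adjacency_def del: upt_Suc)
  qed
  ultimately have "is_cycle (insert {a, b} G) ?xs"
    using n2 by (auto simp: is_cycle_def simp del: upt_Suc)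
  then show ?thesis using n_le by (intro exI[of _ ?xs]) simp
qed

text \<open>A walk replacing the edge \<open>uv\<close> projects to a walk that would close a short cycle in \<open>\<Gamma>\<close>.\<close>

lemma spanner_uses_fibre:
  assumes spanner: "is_spanner (2 * k - 1) n E H" and k: "1 \<le> k"
    and proj: "\<And>f. f \<in> E \<Longrightarrow> \<phi> ` f \<in> \<Gamma>"
    and no_short_cycle: "\<And>xs. is_cycle \<Gamma> xs \<Longrightarrow> 2 * k < length xs"
    and uv: "{u, v} \<in> E" "u < n" "v < n" "\<phi> u \<noteq> \<phi> v"
  shows "\<exists>f\<in>H. \<phi> ` f = {\<phi> u, \<phi> v}"
proof (rule ccontr)
  assume none: "\<not> ?thesis"
  let ?\<gamma> = "{\<phi> u, \<phi> v}"
  have H: "H \<subseteq> E" and dist: "distance H u v \<le> enat (2 * k - 1) * distance E u v"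
    using spanner uv by (auto simp: is_spanner_def)
  have "(u, v) \<in> adjacency E ^^ 1" using uv by (simp add: adjacency_def)
  then have "distance E u v \<le> enat 1"
    unfolding distance_def by (intro INF_lower) auto
  then have "distance H u v \<le> enat (2 * k - 1) * enat 1"
    using dist by (meson mult_left_mono order_trans zero_le)
  also have "\<dots> < enat (2 * k)" using k by simp
  finally obtain m where m: "(u, v) \<in> adjacency H ^^ m" "m < 2 * k"
    unfolding distance_def INF_less_iff by auto
  have walk: "(\<phi> u, \<phi> v) \<in> adjacency (\<Gamma> - {?\<gamma>}) ^^ m"
  proof (rule relpow_map[OF _ m(1)])
    fix x y assume "(x, y) \<in> adjacency H"
    then have xy: "{x, y} \<in> H" by (simp add: adjacency_def)
    then have "\<phi> ` {x, y} \<in> \<Gamma>" "\<phi> ` {x, y} \<noteq> ?\<gamma>" using none proj H by blast+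
    then show "(\<phi> x, \<phi> y) \<in> adjacency (\<Gamma> - {?\<gamma>})" by (simp add: adjacency_def)
  qed
  then obtain xs where "is_cycle (insert ?\<gamma> (\<Gamma> - {?\<gamma>})) xs" "length xs \<le> Suc m"
    using walk_closes_to_cycle[OF walk uv(4)] by auto
  moreover have "insert ?\<gamma> (\<Gamma> - {?\<gamma>}) = \<Gamma>" using proj[OF uv(1)] by auto
  \<comment> \<open>\<open>m\<close> is at most 2k - 1, so the cycle has at most 2k
    vertices.\<close>
  ultimately show False using no_short_cycle[of xs] m by simp
qed

text \<open>The vertices of \<open>\<Gamma>\<close> are blown up along \<open>\<phi>\<close>; over each edge \<open>\<gamma> e\<close> of \<open>\<Gamma>\<close>, player \<open>i\<close> may
  hold the edge \<open>\<epsilon> e i\<close>.\<close>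

lemma blow_up_spanner_cost:
  fixes \<gamma> :: "nat \<Rightarrow> nat set" and \<epsilon> :: "nat \<Rightarrow> nat \<Rightarrow> nat set"
  assumes k: "1 \<le> k" and s: "1 \<le> s" and N: "3456 \<le> N"
    and edge: "\<And>e i. e < N \<Longrightarrow> i < s \<Longrightarrow> \<epsilon> e i \<in> all_edges n"
    and inj: "\<And>e i e' i'. e < N \<Longrightarrow> i < s \<Longrightarrow> e' < N \<Longrightarrow> i' < s \<Longrightarrow> \<epsilon> e i = \<epsilon> e' i' \<Longrightarrow> e = e' \<and> i = i'"
    and proj: "\<And>e i. e < N \<Longrightarrow> i < s \<Longrightarrow> \<phi> ` \<epsilon> e i = \<gamma> e"
    and \<gamma>: "\<And>e. e < N \<Longrightarrow> card (\<gamma> e) = 2" "inj_on \<gamma> {..<N}"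
    and no_short_cycle: "\<And>xs. is_cycle (\<gamma> ` {..<N}) xs \<Longrightarrow> 2 * k < length xs"
  shows "ereal (real s * real N / 10368) \<le> ereal_of_enat (spanner_cost (2 * k - 1) s n)"
proof (cases "spanner_cost (2 * k - 1) s n")
  case (enat M)
  define I where "I = edge_partitions s n"
  define correct where "correct E H \<longleftrightarrow> is_spanner (2 * k - 1) n (\<Union>i<s. E i) H" for E H
  \<comment> \<open>Strict comparison with \<open>Suc M\<close> extracts a protocol of cost at most
    \<open>M\<close> from the infimum.\<close>
  have "(INF \<R>\<in>{\<R>. solves {..<s} I correct \<R>}. worst_case_bits I \<R>) < enat (Suc M)"
    using enat unfolding spanner_cost_def randomized_cost_def I_def correct_def by simp
  then obtain \<R> where solves: "solves {..<s} I correct \<R>" and wc: "worst_case_bits I \<R> < enat (Suc M)"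
    unfolding INF_less_iff by auto
  have bits: "real (bits_of \<pi> x) \<le> real M" if "\<pi> \<in> set_pmf \<R>" "x \<in> I" for \<pi> x
  proof -
    have "enat (bits_of \<pi> x) \<le> worst_case_bits I \<R>"
      unfolding worst_case_bits_def using that by (meson SUP_upper2 order_refl)
    then have "enat (bits_of \<pi> x) < enat (Suc M)" using wc by (rule le_less_trans)
    then show ?thesis by simp
  qed
  define enc where "enc i X = (\<lambda>e. \<epsilon> e i) ` X" for i X
  define inp where "inp R = (\<lambda>j. enc j (R `` {j}))" for R :: "(nat \<times> nat) set"
  have union: "(\<Union>i<s. inp R i) = (\<lambda>(i, e). \<epsilon> e i) ` R" if "R \<subseteq> {..<s} \<times> {..<N}" for R
    using that by (force simp: inp_def enc_def)
  have "real s * real (card {..<N}) \<le> 1728 * (real M * ln 8 + real s * ln 2)"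
  proof (rule randomized_claim_bound[where I = I and correct = correct and \<R> = \<R> and enc = enc
        and claim = "\<lambda>H i e. \<epsilon> e i \<in> H", OF _ solves])
    fix R :: "(nat \<times> nat) set" assume R: "R \<subseteq> {..<s} \<times> {..<N}"
    show "(\<lambda>j. enc j (R `` {j})) \<in> I"
      unfolding I_def edge_partitions_def mem_Collect_eq disjoint_family_on_def
    proof (intro conjI allI impI ballI)
      fix j assume "j < s"
      then show "enc j (R `` {j}) \<subseteq> all_edges n" using R edge by (auto simp: enc_def)
    next
      fix j j' assume j: "j \<in> {..<s}" "j' \<in> {..<s}" "j \<noteq> j'"
      have "\<epsilon> e j \<noteq> \<epsilon> e' j'" if "e < N" "e' < N" for e e'
        using inj[of e j e' j'] that j by auto
      moreover have "R `` {j} \<subseteq> {..<N}" "R `` {j'} \<subseteq> {..<N}" using R by auto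
      ultimately show "enc j (R `` {j}) \<inter> enc j' (R `` {j'}) = {}"
        unfolding enc_def by (auto simp: subset_eq)
    qed
  next
    fix i e R H
    assume i: "i < s" and e: "e \<in> {..<N}" and R: "R \<subseteq> {..<s} \<times> ({..<N} - {e})"
      and "correct (\<lambda>j. enc j (insert (i, e) R `` {j})) H"
    then have spanner: "is_spanner (2 * k - 1) n (\<Union>j<s. inp (insert (i, e) R) j) H"
      by (simp add: correct_def inp_def)
    have sub: "insert (i, e) R \<subseteq> {..<s} \<times> {..<N}" using i e R by auto
    let ?E = "(\<lambda>(i, e). \<epsilon> e i) ` insert (i, e) R"
    obtain u v where uv: "\<epsilon> e i = {u, v}" using edge[of e i] e i by (auto simp: all_edges_def card_2_iff)
    have "\<phi> ` {u, v} = \<gamma> e" using proj[of e i] e i uv by simp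
    then have \<gamma>e: "{\<phi> u, \<phi> v} = \<gamma> e" by simp
    have "\<phi> u \<noteq> \<phi> v"
    proof
      assume "\<phi> u = \<phi> v"
      then have "card (\<gamma> e) = 1" using \<gamma>e by (simp flip: \<gamma>e)
      then show False using \<gamma>(1)[of e] e by simp
    qed
    moreover have "u < n" "v < n" using edge[of e i] e i uv by (auto simp: all_edges_def)
    moreover have "\<phi> ` f \<in> \<gamma> ` {..<N}" if "f \<in> ?E" for f
      using that sub proj by auto
    moreover have "{u, v} \<in> ?E" using uv by (auto simp del: insert_iff intro: insertI1)
    ultimately have "\<exists>f\<in>H. \<phi> ` f = {\<phi> u, \<phi> v}"
      using spanner_uses_fibre[OF spanner[unfolded union[OF sub]] k, of \<phi> "\<gamma> ` {..<N}" u v] no_short_cycle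
      by blast
    \<comment> \<open>Since \<open>R\<close> avoids \<open>e\<close>, the planted edge is the only
      input edge over \<open>\<gamma> e\<close>, so \<open>f\<close> has to be that edge.\<close>
    then obtain f where f: "f \<in> H" "\<phi> ` f = \<gamma> e" using \<gamma>e by auto
    have "H \<subseteq> ?E" using spanner unfolding union[OF sub] is_spanner_def by blast
    with f(1) have "f \<in> ?E" ..
    then obtain z where "z \<in> insert (i, e) R" "f = (case z of (i, e) \<Rightarrow> \<epsilon> e i)" by (rule imageE)
    then obtain i' e' where ie: "(i', e') \<in> insert (i, e) R" "f = \<epsilon> e' i'" by (cases z) auto
    then have "i' < s" "e' < N" using sub by auto
    then have "\<gamma> e' = \<gamma> e" using f ie proj by simp
    then have "e' = e" using \<gamma>(2) e \<open>e' < N\<close> by (auto dest: inj_onD)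
    then have "i' = i" using ie R by auto
    then show "\<epsilon> e i \<in> H" using f ie \<open>e' = e\<close> by simp
  next
    fix i e R H
    assume i: "i < s" and e: "e \<in> {..<N}" and R: "R \<subseteq> {..<s} \<times> ({..<N} - {e})"
      and "correct (\<lambda>j. enc j (R `` {j})) H"
    then have spanner: "is_spanner (2 * k - 1) n (\<Union>j<s. inp R j) H"
      by (simp add: correct_def inp_def)
    have sub: "R \<subseteq> {..<s} \<times> {..<N}" using R by auto
    \<comment> \<open>A spanner is a subgraph, so it contains no edge that nobody holds.\<close>
    show "\<epsilon> e i \<notin> H"
    proof
      assume "\<epsilon> e i \<in> H"
      then have "\<epsilon> e i \<in> (\<lambda>(i, e). \<epsilon> e i) ` R" using spanner union[OF sub] by (auto simp: is_spanner_def)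
      then obtain i' e' where "(i', e') \<in> R" "\<epsilon> e i = \<epsilon> e' i'" by auto
      then show False using inj[of e i e' i'] R i e by auto
    qed
  qed (use s N bits in \<open>auto simp: lessThan_empty_iff\<close>)
  moreover have "ln (8::real) = 3 * ln 2"
    using ln_realpow[of "2::real" 3] by simp
  moreover have ln2: "ln (2::real) \<le> 1" using ln_le_minus_one[of "2::real"] by simp
  moreover have "real M * (3 * ln 2) \<le> real M * 3" "real s * ln 2 \<le> real s * 1"
    using ln2 by (intro mult_left_mono; simp)+
  \<comment> \<open>5184 = 3 * 1728. As \<open>N\<close> is at least 3456 = 2 * 1728, the term 1728
    s is at most half of the left side, which doubles 5184 to 10368.\<close>
  ultimately have "real s * real N \<le> 5184 * real M + 1728 * real s" by simp
  moreover have "real s * 3456 \<le> real s * real N" using N by (intro mult_left_mono) auto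
  ultimately have "real s * real N \<le> 10368 * real M" by simp
  then show ?thesis unfolding enat by simp
qed simp

section \<open>The two blown-up graphs: star and girth graph\<close>

text \<open>The vertices below \<open>s\<close> are the copies of the centre 0, one per player; the
  other n - s vertices are the leaves. A star has no cycles at all, so every \<open>k\<close> is
  covered.\<close>

lemma star_spanner_cost:
  assumes "1 \<le> k" "1 \<le> s" "s + 3456 \<le> n"
  shows "ereal (real s * real (n - s) / 10368) \<le> ereal_of_enat (spanner_cost (2 * k - 1) s n)"
proof (rule blow_up_spanner_cost[where \<epsilon> = "\<lambda>e i. {i, s + e}" and \<gamma> = "\<lambda>e. {0, s + e}"
      and \<phi> = "\<lambda>v. if v < s then 0 else v"])
  fix xs assume cycle: "is_cycle ((\<lambda>e. {0, s + e}) ` {..<n - s}) xs"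
  then have len: "3 \<le> length xs" and dist: "distinct xs"
    by (auto simp: is_cycle_def)
  then have "xs \<noteq> []" by auto
  have edges: "0 \<in> {xs ! i, xs ! (Suc i mod length xs)}" if "i < length xs" for i
  proof -
    have "{xs ! i, xs ! (Suc i mod length xs)} \<in> (\<lambda>e. {0, s + e}) ` {..<n - s}"
      using cycle that by (auto simp: is_cycle_def)
    then obtain e where "{xs ! i, xs ! (Suc i mod length xs)} = {0, s + e}" by blast
    then show ?thesis by simp
  qed
  \<comment> \<open>The index after 2 on the cycle: 0 for a triangle, 3 otherwise. To meet the first
    two edges the centre must sit at index 1, and then it misses the edge from index 2 to
    \<open>j\<close>.\<close>
  define j where "j = 3 mod length xs"
  have j: "j < length xs" "j \<noteq> 1" using len by (auto simp: j_def mod_if)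
  have "0 \<in> {xs ! 0, xs ! 1}" "0 \<in> {xs ! 1, xs ! 2}" "0 \<in> {xs ! 2, xs ! j}"
    using edges[of 0] edges[of 1] edges[of 2] len \<open>xs \<noteq> []\<close> by (simp_all add: j_def eval_nat_numeral)
  moreover have "xs ! a \<noteq> xs ! b" if "a < length xs" "b < length xs" "a \<noteq> b" for a b
    using that dist by (simp add: nth_eq_iff_index_eq)
  from this[of 0 1] this[of 0 2] this[of 1 2] this[of 1 j]
  have "xs ! 0 \<noteq> xs ! 1" "xs ! 0 \<noteq> xs ! 2" "xs ! 1 \<noteq> xs ! 2" "xs ! 1 \<noteq> xs ! j"
    using len j \<open>xs \<noteq> []\<close> by simp_all
  ultimately have False by auto
  then show "2 * k < length xs" ..
qed (use assms in \<open>auto simp: all_edges_def inj_on_def doubleton_eq_iff card_2_iff\<close>)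

text \<open>Each vertex gets \<open>r\<close> copies, the fibres of division by \<open>r\<close>.
  Over an edge there are r * r \<ge> s pairs of copies, and player \<open>i\<close> owns the pair
  given by the two digits of \<open>i\<close> in base \<open>r\<close>.\<close>

lemma girth_graph_spanner_cost:
  assumes k: "1 \<le> k" and s: "1 \<le> s" and r: "s \<le> r * r" "m * r \<le> n"
    and E: "E \<subseteq> all_edges m" "girth E = enat (2 * k + 2)" "3456 \<le> card E"
  shows "ereal (real s * real (card E) / 10368) \<le> ereal_of_enat (spanner_cost (2 * k - 1) s n)"
proof -
  have r0: "0 < r" using r s by (cases r) auto
  have "finite E"
    using E(3) card.infinite by fastforce
  then obtain \<gamma> where bij: "bij_betw \<gamma> {..<card E} E"
    using ex_bij_betw_nat_finite[of E] by (auto simp: atLeast0LessThan)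
  have \<gamma>E: "\<gamma> e \<in> E" if "e < card E" for e using bij that by (auto simp: bij_betw_def)
  \<comment> \<open>Ordering the two ends of each edge fixes which end receives the quotient and
    which the remainder.\<close>
  define a where "a e = Min (\<gamma> e)" for e
  define b where "b e = Max (\<gamma> e)" for e
  have ab: "\<gamma> e = {a e, b e}" "a e \<noteq> b e" "a e < m" "b e < m" if "e < card E" for e
  proof -
    have "\<gamma> e \<subseteq> {..<m}" "card (\<gamma> e) = 2" using \<gamma>E[OF that] E(1) by (auto simp: all_edges_def)
    then obtain x y where "\<gamma> e = {x, y}" "x \<noteq> y" "x < m" "y < m" by (auto simp: card_2_iff)
    then show "\<gamma> e = {a e, b e}" "a e \<noteq> b e" "a e < m" "b e < m"
      by (auto simp: a_def b_def min_def max_def)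
  qed
  define \<epsilon> where "\<epsilon> e i = {a e * r + i div r, b e * r + i mod r}" for e i
  have idiv: "i div r < r" if "i < s" for i
    using that r(1) by (simp add: less_mult_imp_div_less)
  have imod: "i mod r < r" for i using r0 by simp
  have div: "(x * r + y) div r = x" if "y < r" for x y using that r0 by simp
  have less: "x * r + y < n" if "x < m" "y < r" for x y
  proof -
    have "x * r + y < Suc x * r" using that by simp
    also have "\<dots> \<le> m * r" using that by (intro mult_le_mono1) simp
    finally show ?thesis using r(2) by simp
  qed
  have proj: "(\<lambda>v. v div r) ` \<epsilon> e i = \<gamma> e" if "e < card E" "i < s" for e i
    using ab(1)[OF that(1)] div[OF idiv[OF that(2)], of "a e"] div[OF imod, of "b e" i]
    by (simp add: \<epsilon>_def)
  show ?thesis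
  proof (rule blow_up_spanner_cost[where \<gamma> = \<gamma> and \<epsilon> = \<epsilon> and \<phi> = "\<lambda>v. v div r"])
    fix e i assume ei: "e < card E" "i < s"
    have "a e * r + i div r \<noteq> b e * r + i mod r"
      using ab(2)[OF ei(1)] div[OF idiv[OF ei(2)], of "a e"] div[OF imod, of "b e" i] by metis
    then show "\<epsilon> e i \<in> all_edges n"
      using less[OF ab(3)[OF ei(1)] idiv[OF ei(2)]] less[OF ab(4)[OF ei(1)] imod, of i]
      by (simp add: \<epsilon>_def all_edges_def)
  next
    fix e i e' i' assume *: "e < card E" "i < s" "e' < card E" "i' < s" "\<epsilon> e i = \<epsilon> e' i'"
    then have "\<gamma> e = \<gamma> e'" using proj by metis
    then have e: "e = e'" using bij * by (auto simp: bij_betw_def dest: inj_onD)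
    \<comment> \<open>Copies of different vertices are different, so the two pairs cannot agree
      crosswise.\<close>
    have "a e * r + i div r \<noteq> b e * r + i' mod r"
      using ab(2)[OF *(1)] div[OF idiv[OF *(2)], of "a e"] div[OF imod, of "b e" i'] by metis
    then have "a e * r + i div r = a e * r + i' div r" "b e * r + i mod r = b e * r + i' mod r"
      using *(5) e by (auto simp: \<epsilon>_def doubleton_eq_iff)
    then show "e = e' \<and> i = i'" using e by (metis add_left_cancel div_mult_mod_eq)
  next
    fix xs assume "is_cycle (\<gamma> ` {..<card E}) xs"
    then have "is_cycle E xs" using bij by (simp add: bij_betw_def)
    then have "girth E \<le> enat (length xs)" unfolding girth_def by (intro INF_lower) simp
    then show "2 * k < length xs" using E(2) by simp
  next
    fix e assume "e < card E"
    then show "card (\<gamma> e) = 2" using ab by simp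
  qed (use k s E bij proj in \<open>auto simp: bij_betw_def\<close>)
qed

section \<open>Choice of parameters and asymptotics\<close>

text \<open>With r about sqrt s and m about n / sqrt s, the blow-up costs of order s * (n / sqrt
  s)^(1 + 1/k), which is the stated term.\<close>

lemma girth_term_bound:
  assumes conj: "erdos_girth_conjecture" and k: "1 \<le> k"
  shows "\<exists>c>0. \<forall>\<^sub>F n in sequentially. \<forall>s. 1 \<le> s \<and> s \<le> n \<longrightarrow>
    ereal (c * (real s powr (1 / 2 - 1 / (2 * real k)) * real n powr (1 + 1 / real k)))
      \<le> ereal_of_enat (spanner_cost (2 * k - 1) s n)"
proof -
  define p where "p = 1 + 1 / real k"
  have p: "1 \<le> p" by (simp add: p_def)
  obtain c where c: "0 < c" and "\<forall>\<^sub>F m in sequentially. \<exists>E. E \<subseteq> all_edges m \<and>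
      c * real m powr p \<le> real (card E) \<and> girth E = enat (2 * k + 2)"
    using conj k unfolding erdos_girth_conjecture_def p_def by blast
  then obtain m0 where m0: "\<And>m. m0 \<le> m \<Longrightarrow> \<exists>E. E \<subseteq> all_edges m \<and>
      c * real m powr p \<le> real (card E) \<and> girth E = enat (2 * k + 2)"
    unfolding eventually_sequentially by blast
  \<comment> \<open>For m \<ge> K the conjecture supplies a graph, m^p is at least m, and there are
    at least 3456 edges.\<close>
  define K where "K = max (max (real m0) 1) (3456 / c)"
  have K: "real m0 \<le> K" "1 \<le> K" "3456 / c \<le> K" by (auto simp: K_def)
  \<comment> \<open>The factor 4^p pays for m \<ge> n / (4q), and 10368 comes from the blow-up
    bound.\<close>
  define d where "d = c / (10368 * 4 powr p)"
  have "0 < d" using c by (simp add: d_def)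
  \<comment> \<open>As q is at most sqrt n, this gives m \<ge> K for all \<open>s\<close> at
    once.\<close>
  moreover have "\<forall>\<^sub>F n in sequentially. 4 * K \<le> sqrt (real n)"
    by real_asymp
  then have "\<forall>\<^sub>F n in sequentially. \<forall>s. 1 \<le> s \<and> s \<le> n \<longrightarrow>
    ereal (d * (real s powr (1 / 2 - 1 / (2 * real k)) * real n powr p))
      \<le> ereal_of_enat (spanner_cost (2 * k - 1) s n)"
  proof eventually_elim
    case (elim n)
    show ?case
    proof (intro allI impI, elim conjE)
      fix s :: nat assume s: "1 \<le> s" "s \<le> n"
      define q where "q = sqrt (real s)"
      have q: "1 \<le> q" "q \<le> sqrt (real n)" "q * q = real s" using s by (auto simp: q_def)
      define r where "r = nat \<lceil>q\<rceil>"
      have r: "q \<le> real r" "real r \<le> 2 * q"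
        unfolding r_def using q(1) by linarith+
      have r0: "0 < r" using r(1) q(1) by (cases r) auto
      have "real s \<le> real r * real r" unfolding q(3)[symmetric] using r q by (intro mult_mono) auto
      then have rr: "s \<le> r * r" by (simp flip: of_nat_mult)
      define m where "m = n div r"
      have "4 * q \<le> real n"
      proof -
        have "4 * q \<le> sqrt (real n) * sqrt (real n)"
          using q K(2) elim by (intro mult_mono) auto
        then show ?thesis by simp
      qed
      \<comment> \<open>With x = n / (4q) \<ge> 1, rounding down leaves m \<ge> 2x - 1 \<ge>
        x.\<close>
      then have big: "1 \<le> real n / (4 * q)" using q by (simp add: field_simps)
      have "real n / (2 * q) \<le> real n / real r"
        using r q by (intro divide_left_mono) auto
      also have "\<dots> \<le> real m + 1"
      proof -
        have "n < (m + 1) * r" unfolding m_def using dividend_less_div_times[OF r0, of n] by simp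
        then have "real n \<le> real ((m + 1) * r)" by (simp only: of_nat_le_iff less_imp_le)
        then show ?thesis using r0 by (simp add: field_simps)
      qed
      finally have "real n / (2 * q) \<le> real m + 1" .
      moreover have "real n / (2 * q) = 2 * (real n / (4 * q))" using q by (simp add: field_simps)
      ultimately have m: "real n / (4 * q) \<le> real m" using big by linarith
      have "K \<le> sqrt (real n) / 4" using elim by simp
      also have "\<dots> = real n / (4 * sqrt (real n))"
        by (simp add: real_div_sqrt)
      also have "\<dots> \<le> real n / (4 * q)"
      proof (rule divide_left_mono)
        have "0 < q" "0 < sqrt (real n)" using q by linarith+
        then show "0 < 4 * sqrt (real n) * (4 * q)" by simp
      qed (use q in auto)
      finally have Km: "K \<le> real m" using m by linarith
      then obtain E where E: "E \<subseteq> all_edges m" "c * real m powr p \<le> real (card E)"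
          "girth E = enat (2 * k + 2)"
        using m0[of m] K(1) by auto
      have "3456 \<le> c * K" using K(3) c by (simp add: field_simps)
      also have "\<dots> \<le> c * real m" using Km c by simp
      also have "\<dots> \<le> c * real m powr p"
        using powr_mono[OF p, of "real m"] Km K(2) c by simp
      also have "\<dots> \<le> real (card E)" by (rule E)
      finally have cardE: "3456 \<le> card E" by simp
      have cost: "ereal (real s * real (card E) / 10368) \<le> ereal_of_enat (spanner_cost (2 * k - 1) s n)"
        by (rule girth_graph_spanner_cost[OF k s(1) rr _ E(1,3) cardE]) (simp add: m_def)
      \<comment> \<open>1/2 - 1/(2k) = 1 - p/2, and s^(p/2) = q^p.\<close>
      have "real s powr (1 / 2 - 1 / (2 * real k)) = real s powr (1 - p / 2)"
        by (simp add: p_def add_divide_distrib mult.commute)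
      also have "\<dots> = real s / q powr p"
        using s by (simp add: q_def powr_diff powr_half_sqrt[symmetric] powr_powr mult.commute)
      finally have "d * (real s powr (1 / 2 - 1 / (2 * real k)) * real n powr p) =
          real s * (c * (real n / (4 * q)) powr p) / 10368"
        using q by (simp add: d_def powr_divide powr_mult mult_ac)
      also have "\<dots> \<le> real s * (c * real m powr p) / 10368"
        using m c p big by (intro divide_right_mono mult_left_mono powr_mono2) auto
      also have "\<dots> \<le> real s * real (card E) / 10368"
        by (intro divide_right_mono mult_left_mono E) auto
      finally show "ereal (d * (real s powr (1 / 2 - 1 / (2 * real k)) * real n powr p))
          \<le> ereal_of_enat (spanner_cost (2 * k - 1) s n)"
        using cost by (meson ereal_less_eq(3) order_trans)
    qed
  qed
  ultimately show ?thesis unfolding p_def by blast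
qed

theorem theorem4p9:
  fixes k :: nat
  assumes "k \<ge> 1"
    and "erdos_girth_conjecture"
  shows "\<exists>c::real. c > 0 \<and> (\<exists>\<delta>::real. \<delta> > 0 \<and> (\<exists>n\<^sub>0::nat. \<forall>n\<ge>n\<^sub>0. \<forall>s::nat.
           1 \<le> s \<and> real s \<le> \<delta> * real n \<longrightarrow>
             ereal (c * (real s powr (1 / 2 - 1 / (2 * real k)) * real n powr (1 + 1 / real k)
                         + real s * real n))
               \<le> ereal_of_enat (spanner_cost (2 * k - 1) s n)))"
proof -
  obtain c n1 where c: "0 < c" and girth_term: "\<And>n s. n1 \<le> n \<Longrightarrow> 1 \<le> s \<Longrightarrow> s \<le> n \<Longrightarrow>
      ereal (c * (real s powr (1 / 2 - 1 / (2 * real k)) * real n powr (1 + 1 / real k)))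
        \<le> ereal_of_enat (spanner_cost (2 * k - 1) s n)"
    using girth_term_bound[OF assms(2,1)] unfolding eventually_sequentially by blast
  \<comment> \<open>Each of the two terms, multiplied by 2d, is at most the cost, so d times their
    sum is too. The constant 20736 = 2 * 10368 allows for n - s \<ge> n/2.\<close>
  define d where "d = min c (1 / 20736) / 2"
  have d: "0 < d" "2 * d \<le> c" "2 * d \<le> 1 / 20736" using c by (auto simp: d_def)
  have "ereal (d * (real s powr (1 / 2 - 1 / (2 * real k)) * real n powr (1 + 1 / real k)
        + real s * real n)) \<le> ereal_of_enat (spanner_cost (2 * k - 1) s n)"
    if n: "max n1 6912 \<le> n" and s: "1 \<le> s" "real s \<le> 1/2 * real n" for n s :: nat
  proof (cases "spanner_cost (2 * k - 1) s n")
    case (enat M)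
    let ?X = "real s powr (1 / 2 - 1 / (2 * real k)) * real n powr (1 + 1 / real k)"
    have "2 * d * ?X \<le> c * ?X" using d by (intro mult_right_mono) auto
    also have "\<dots> \<le> real M"
      using girth_term[of n s, unfolded enat] n s by simp
    finally have 1: "2 * d * ?X \<le> real M" .
    \<comment> \<open>n \<ge> 6912 = 2 * 3456 and s \<le> n/2 leave at least 3456 leaves.\<close>
    have "s \<le> n" "s + 3456 \<le> n" using s n by linarith+
    have "2 * d * (real s * real n) \<le> 1 / 20736 * (real s * real n)"
      using d by (intro mult_right_mono) auto
    also have "\<dots> = real s * (real n / 2) / 10368" by simp
    also have "\<dots> \<le> real s * real (n - s) / 10368"
      using s \<open>s \<le> n\<close> by (intro divide_right_mono mult_left_mono) auto
    also have "\<dots> \<le> real M"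
      using star_spanner_cost[OF assms(1) s(1) \<open>s + 3456 \<le> n\<close>, unfolded enat] by simp
    finally have "2 * d * (real s * real n) \<le> real M" .
    with 1 have "d * (?X + real s * real n) \<le> real M" by (simp add: algebra_simps)
    then show ?thesis unfolding enat by simp
  qed simp
  then have "0 < (1/2 :: real) \<and> (\<exists>n\<^sub>0::nat. \<forall>n\<ge>n\<^sub>0. \<forall>s::nat. 1 \<le> s \<and> real s \<le> 1/2 * real n \<longrightarrow>
      ereal (d * (real s powr (1 / 2 - 1 / (2 * real k)) * real n powr (1 + 1 / real k)
        + real s * real n)) \<le> ereal_of_enat (spanner_cost (2 * k - 1) s n))"
    by (intro conjI exI[of _ "max n1 6912"]) auto
  then show ?thesis using d(1) by blast
qed

end
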